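(* Let $k$ be a positive integer, let $p$ be an odd integer with $p\ge 3$, and let $\delta_1,\ldots,\delta_m$ be positive integers with $\delta_i\ge p-1$ for all $i$ and $kp=\delta_1+\cdots+ \delta_m$. Let $G$ be a graph of even order satisfying $\delta(G)\ge \delta_1+\cdots+ \delta_m$ and let $V_0=\{v\in V(G): d_G(v)\le kp+k-2\}$. If $G$ is $V_0$-partially odd-$(3k-3, V_0)$-edge-connected, then $G$ can be edge-decomposed into factors $G_1,\ldots, G_m$ satisfying $\delta(G_i)\ge \delta_i$ for all $i$ with $1\le i \le m$.
   Context: Graphs may have loops and multiple edges; $d_G(v)$ is the degree of $v$ in $G$ (a loop counts twice), and $\delta(G)$ is the minimum degree. A factor of $G$ is a spanning subgraph of $G$; $G$ is edge-decomposed into factors if their edge sets partition $E(G)$. For a vertex set $A$, $d_G(A)$ is the number of edges of $G$ with exactly one end in $A$. For vertex sets $V_0$ and $Q$, $G$ is $V_0$-partially odd-$(\lambda, Q)$-edge-connected if $d_G(A)\ge \lambda$ for all subsets $A$ of $V_0$ with $|A\cap Q|$ odd. *)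

theory Defs
  imports Main "HOL-Library.Uprod" "HOL-Library.Disjoint_Sets"
begin

text \<open>An edge is an identifier mapped to an unordered pair of ends, so parallel edges are
  distinct identifiers with equal ends, and a loop at \<open>v\<close> has ends \<open>Upair v v\<close>.\<close>

record ('v, 'e) mgraph =
  verts :: "'v set"
  edges :: "'e set"
  ends :: "'e \<Rightarrow> 'v uprod"

locale finite_mgraph =
  fixes G :: "('v, 'e) mgraph"
  assumes finite_verts: "finite (verts G)"
    and finite_edges: "finite (edges G)"
    and ends_in_verts: "e \<in> edges G \<Longrightarrow> set_uprod (ends G e) \<subseteq> verts G"

text \<open>The second summand makes a loop contribute 2.\<close>

definition degree :: "('v, 'e) mgraph \<Rightarrow> 'v \<Rightarrow> nat" where
  "degree G v =
     card {e \<in> edges G. v \<in> set_uprod (ends G e)} + card {e \<in> edges G. ends G e = Upair v v}"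

text \<open>Meaningful for a nonempty vertex set only; otherwise it is the unspecified \<open>Min {}\<close>.\<close>

definition min_degree :: "('v, 'e) mgraph \<Rightarrow> nat" where
  "min_degree G = Min (degree G ` verts G)"

definition cut_degree :: "('v, 'e) mgraph \<Rightarrow> 'v set \<Rightarrow> nat" where
  "cut_degree G A = card {e \<in> edges G. \<exists>u w. ends G e = Upair u w \<and> u \<in> A \<and> w \<notin> A}"

definition partially_odd_edge_connected ::
    "('v, 'e) mgraph \<Rightarrow> 'v set \<Rightarrow> nat \<Rightarrow> 'v set \<Rightarrow> bool" where
  "partially_odd_edge_connected G V0 l Q \<longleftrightarrow>
     (\<forall>A. A \<subseteq> V0 \<longrightarrow> odd (card (A \<inter> Q)) \<longrightarrow> l \<le> cut_degree G A)"

definition is_factor :: "('v, 'e) mgraph \<Rightarrow> ('v, 'e) mgraph \<Rightarrow> bool" where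
  "is_factor H G \<longleftrightarrow>
     verts H = verts G \<and> edges H \<subseteq> edges G \<and> (\<forall>e \<in> edges H. ends H e = ends G e)"

definition edge_decomposition ::
    "('v, 'e) mgraph \<Rightarrow> 'i set \<Rightarrow> ('i \<Rightarrow> ('v, 'e) mgraph) \<Rightarrow> bool" where
  "edge_decomposition G I H \<longleftrightarrow>
     (\<forall>i \<in> I. is_factor (H i) G) \<and>
     disjoint_family_on (\<lambda>i. edges (H i)) I \<and>
     (\<Union>i \<in> I. edges (H i)) = edges G"

end

theory Submission imports Defs begin

text \<open>
  The proof looks for \<open>k\<close> factors of minimum degree at least \<open>p\<close> and then redistributes them.
  Since \<open>p - 1\<close> is even, an odd \<open>\<delta> i\<close> is at least \<open>p\<close>, so the number \<open>\<kappa>\<close> of odd values is at most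
  \<open>k\<close>. Every odd \<open>\<delta> i\<close> receives one of the \<open>k\<close> factors. The other \<open>k - \<kappa>\<close> factors together have all
  degrees at least \<open>(k - \<kappa>) * p\<close>, which is even, and split into \<open>(k - \<kappa>) * p / 2\<close> classes of minimum
  degree 2 (\<open>min_degree_two_classes\<close>): orient the edges so that in- and outdegrees differ by at most
  one, and colour the bipartite graph between tails and heads equitably. What an index \<open>i\<close> still
  lacks is even and is filled up with such classes (\<open>min_degree_decomposition\<close>).

  For the \<open>k\<close> factors, degrees are balanced while parities are kept. Any two colour classes can be
  recoloured so that their degrees at every vertex differ by at most 2 and the number of classes of even
  degree at a vertex stays the same (\<open>parity_balanced_coloring\<close>). If a vertex had degree below
  \<open>p\<close> in some class of a balanced colouring, its degree would be at most
  \<open>(p - 1) + (k - 1) * (p + 1) = k * p + k - 2\<close>; so only vertices of \<open>V0\<close> matter. At these, it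
  suffices that at most one class has even degree: a class of degree \<open>p - 1\<close> would be that class, the
  others would have odd degree at most \<open>p\<close>, and the total would be less than \<open>k * p\<close>; if a class has
  degree less than \<open>p - 1\<close>, the others have degree at most \<open>p\<close> in any case (\<open>min_degree_k_factors\<close>).

  There remains a question modulo 2: colour the edges so that every vertex of \<open>V0\<close> has odd degree in
  every colour, after an edge to an additional vertex was added where the parity of the degree
  requires it. Odd cuts of size at least \<open>2 * k - 2\<close> make this possible (\<open>odd_coloring\<close>). More generally let some
  vertices be labelled odd and the others even. A vertex labelled even is removed by splitting off
  pairs of its edges; an uncrossing argument (\<open>admissible_slide\<close>) finds a pair that keeps the odd
  cuts large. If all labels are odd, then all degrees are at least \<open>2 * k - 2\<close>, hence there are
  more than \<open>(k - 1) * (n - 1)\<close> edges, and the exchange argument for packing spanning trees provides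
  a vertex set \<open>U\<close> that is connected by each of \<open>k - 1\<close> disjoint edge sets
  (\<open>dense_connected_subset\<close>). Contract \<open>U\<close> and colour by induction. Whatever the colours at the
  boundary of \<open>U\<close>, the parities of the first \<open>k - 1\<close> colours inside \<open>U\<close> are corrected by joins in
  these edge sets, and the last colour is then correct because the degrees are.
\<close>

section \<open>Balanced orientations\<close>

text \<open>A multigraph is a set of edges together with a map that assigns a vertex to each of the two halves
  \<open>False\<close> and \<open>True\<close> of an edge. A loop has both halves at the same vertex.\<close>

definition ends_at :: "('e \<Rightarrow> bool \<Rightarrow> 'v) \<Rightarrow> 'e \<Rightarrow> 'v \<Rightarrow> nat" where
  "ends_at en e v = of_bool (en e False = v) + of_bool (en e True = v)"

definition deg :: "'e set \<Rightarrow> ('e \<Rightarrow> bool \<Rightarrow> 'v) \<Rightarrow> 'v \<Rightarrow> nat" where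
  "deg E en v = (\<Sum>e\<in>E. ends_at en e v)"

text \<open>Splitting off: if half \<open>i\<close> of \<open>f\<close> and half \<open>j\<close> of \<open>g\<close> meet at a vertex, half \<open>j\<close> of \<open>g\<close> moves
  along \<open>f\<close> to the other end of \<open>f\<close>. After deletion of \<open>f\<close>, the edge \<open>g\<close> stands for the path formed by the two edges.\<close>

definition slide :: "('e \<Rightarrow> bool \<Rightarrow> 'v) \<Rightarrow> 'e \<Rightarrow> bool \<Rightarrow> 'e \<Rightarrow> bool \<Rightarrow> 'e \<Rightarrow> bool \<Rightarrow> 'v" where
  "slide en f i g j = en(g := (en g)(j := en f (\<not> i)))"

text \<open>The sign \<open>w e\<close> says whether \<open>e\<close> leaves or enters its half \<open>True\<close>. Replacing two edges that
  share a vertex by a single one and orienting both along it contributes nothing at the shared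
  vertex; a graph in which no two edges meet is balanced by any orientation.\<close>

lemma balanced_orientation:
  assumes "finite E"
  shows "\<exists>w :: 'e \<Rightarrow> int. (\<forall>e. w e = 1 \<or> w e = -1) \<and>
    (\<forall>v :: 'v. \<bar>\<Sum>e\<in>E. w e * (of_bool (en e True = v) - of_bool (en e False = v))\<bar> \<le> 1)"
  using assms
proof (induction "card E" arbitrary: E en rule: less_induct)
  case less
  show ?case
  proof (cases "\<exists>f\<in>E. \<exists>g\<in>E. \<exists>i j. f \<noteq> g \<and> en f i = en g j")
    case True
    then obtain f g i j where fg: "f \<in> E" "g \<in> E" "f \<noteq> g" "en f i = en g j" by blast
    let ?en = "slide en f i g j"
    have "card (E - {f}) < card E" using less.prems fg by (meson card_Diff1_less)
    then obtain w :: "'e \<Rightarrow> int" where w: "\<forall>e. w e = 1 \<or> w e = -1"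
      "\<forall>v. \<bar>\<Sum>e\<in>E - {f}. w e * (of_bool (?en e True = v) - of_bool (?en e False = v))\<bar> \<le> 1"
      using less.hyps[of "E - {f}" ?en] less.prems by blast
    \<comment> \<open>The path is oriented consistently; its two edges have the same sign iff they meet in opposite halves.\<close>
    let ?w = "w(f := if i = j then - w g else w g)"
    have "(\<Sum>e\<in>E. ?w e * (of_bool (en e True = v) - of_bool (en e False = v))) =
      (\<Sum>e\<in>E - {f}. w e * (of_bool (?en e True = v) - of_bool (?en e False = v)))" for v
    proof -
      have E: "E = insert f (insert g (E - {f, g}))" "E - {f} = insert g (E - {f, g})" using fg by auto
      have rest: "(\<Sum>e\<in>E - {f, g}. ?w e * (of_bool (en e True = v) - of_bool (en e False = v))) =
        (\<Sum>e\<in>E - {f, g}. w e * (of_bool (?en e True = v) - of_bool (?en e False = v)))"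
        by (rule sum.cong) (auto simp: slide_def)
      show ?thesis
        apply (subst E(1), subst E(2))
        using less.prems fg rest
        by (cases i; cases j) (auto simp: slide_def algebra_simps)
    qed
    then have "\<forall>v. \<bar>\<Sum>e\<in>E. ?w e * (of_bool (en e True = v) - of_bool (en e False = v))\<bar> \<le> 1"
      using w(2) by simp
    moreover have "\<forall>e. ?w e = 1 \<or> ?w e = -1" using w(1) by (auto simp: fun_upd_def)
    ultimately show ?thesis by blast
  next
    case False
    have "\<bar>\<Sum>e\<in>E. 1 * (of_bool (en e True = v) - of_bool (en e False = v))\<bar> \<le> (1::int)" for v
    proof (cases "\<exists>e\<in>E. \<exists>i. en e i = v")
      case True
      then obtain e i where e: "e \<in> E" "en e i = v" by blast
      have "en e' j \<noteq> v" if "e' \<in> E - {e}" for e' j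
      proof
        assume "en e' j = v"
        then have "\<exists>f\<in>E. \<exists>g\<in>E. \<exists>i j. f \<noteq> g \<and> en f i = en g j"
          using e that by (intro bexI[of _ e] bexI[of _ e'] exI[of _ i] exI[of _ j]) auto
        then show False using False by contradiction
      qed
      then have "(\<Sum>e\<in>E - {e}. 1 * (of_bool (en e True = v) - of_bool (en e False = v))) = (0::int)"
        by (intro sum.neutral) auto
      then show ?thesis using e less.prems by (subst sum.remove[of E e]) auto
    next
      case False
      then have "(\<Sum>e\<in>E. 1 * (of_bool (en e True = v) - of_bool (en e False = v))) = (0::int)"
        by (intro sum.neutral) auto
      then show ?thesis by simp
    qed
    then show ?thesis by (intro exI[of _ "\<lambda>_. 1"]) auto
  qed
qed

text \<open>Orient the bipartite graph in a balanced way and colour an edge by the side at which it starts: out- and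
  indegree become the two colour degrees.\<close>

lemma equitable_bipartite_two_coloring:
  assumes "finite E"
  shows "\<exists>\<phi> :: 'e \<Rightarrow> int. (\<forall>e. \<phi> e = 1 \<or> \<phi> e = -1) \<and>
    (\<forall>x :: 'a. \<bar>\<Sum>e\<in>{e\<in>E. l e = x}. \<phi> e\<bar> \<le> 1) \<and> (\<forall>y :: 'b. \<bar>\<Sum>e\<in>{e\<in>E. r e = y}. \<phi> e\<bar> \<le> 1)"
proof -
  let ?en = "\<lambda>e h. if h then Inl (l e) else Inr (r e)"
  obtain w :: "'e \<Rightarrow> int" where w: "\<forall>e. w e = 1 \<or> w e = -1"
    "\<forall>v. \<bar>\<Sum>e\<in>E. w e * (of_bool (?en e True = v) - of_bool (?en e False = v))\<bar> \<le> 1"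
    using balanced_orientation[OF assms, of ?en] by blast
  have left: "(\<Sum>e\<in>E. w e * (of_bool (?en e True = Inl x) - of_bool (?en e False = Inl x))) = (\<Sum>e\<in>{e\<in>E. l e = x}. w e)" for x
    unfolding sum.inter_filter[OF assms, of w "\<lambda>e. l e = x"] by (rule sum.cong) auto
  have right: "(\<Sum>e\<in>E. w e * (of_bool (?en e True = Inr y) - of_bool (?en e False = Inr y))) = - (\<Sum>e\<in>{e\<in>E. r e = y}. w e)" for y
    unfolding sum.inter_filter[OF assms, of w "\<lambda>e. r e = y"] sum_negf[symmetric] by (rule sum.cong) auto
  have "\<bar>\<Sum>e\<in>{e\<in>E. l e = x}. w e\<bar> \<le> 1" for x
    using w(2)[rule_format, of "Inl x"] unfolding left .
  moreover have "\<bar>\<Sum>e\<in>{e\<in>E. r e = y}. w e\<bar> \<le> 1" for y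
    using w(2)[rule_format, of "Inr y"] unfolding right abs_minus_cancel .
  ultimately show ?thesis using w(1) by blast
qed

lemma even_sum_signs:
  fixes \<phi> :: "'e \<Rightarrow> int"
  assumes "finite E" "\<forall>e\<in>E. odd (\<phi> e)"
  shows "even (sum \<phi> E) \<longleftrightarrow> even (card E)"
  using assms by (induction E rule: finite_induct) auto

lemma even_abs_le_1: "even (x :: int) \<Longrightarrow> \<bar>x\<bar> \<le> 1 \<Longrightarrow> x = 0"
  by presburger

section \<open>Balancing two colour classes while keeping parities\<close>

text \<open>Orient the graph and split every vertex into its tails and its heads; an equitable
  two-colouring of this bipartite graph makes both partial sums at a vertex at most 1. They vanish
  if there is an even number of edges on the side. If the degree is twice an odd number, both partial sums are odd;
  an additional edge joining the tail copy to the head copy forces them to agree, so that their sum is 2 or -2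
  and never 0. This gives the congruence modulo 4, which controls the parity of each colour class.\<close>

lemma balanced_signing:
  fixes en :: "'e \<Rightarrow> bool \<Rightarrow> 'v"
  assumes fin: "finite E"
  shows "\<exists>\<phi> :: 'e \<Rightarrow> int. (\<forall>e. \<phi> e = 1 \<or> \<phi> e = -1) \<and>
    (\<forall>v. let D = (\<Sum>e\<in>E. \<phi> e * int (ends_at en e v)) in
      (odd (deg E en v) \<longrightarrow> \<bar>D\<bar> \<le> 1) \<and> (even (deg E en v) \<longrightarrow> \<bar>D\<bar> \<le> 2 \<and> 4 dvd D - int (deg E en v)))"
proof -
  obtain w :: "'e \<Rightarrow> int" where w: "\<And>e. w e = 1 \<or> w e = -1"
    "\<And>v. \<bar>\<Sum>e\<in>E. w e * (of_bool (en e True = v) - of_bool (en e False = v))\<bar> \<le> 1"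
    using balanced_orientation[OF assms, of en] by blast
  define src tgt where "src = (\<lambda>e. en e (w e = 1))" and "tgt = (\<lambda>e. en e (w e \<noteq> 1))"
  \<comment> \<open>Outdegree and indegree agree and are odd exactly at these vertices; elsewhere a partial sum vanishes.\<close>
  define L where "L = {v. v \<in> src ` E \<and> even (deg E en v) \<and> odd (deg E en v div 2)}"
  define E' where "E' = Inl ` E \<union> Inr ` L"
  have finE': "finite E'" using fin by (auto simp: E'_def L_def)
  obtain \<psi> :: "'e + 'v \<Rightarrow> int" where \<psi>: "\<And>e. \<psi> e = 1 \<or> \<psi> e = -1"
    "\<And>x. \<bar>\<Sum>e\<in>{e\<in>E'. case_sum src id e = x}. \<psi> e\<bar> \<le> 1"
    "\<And>x. \<bar>\<Sum>e\<in>{e\<in>E'. case_sum tgt id e = x}. \<psi> e\<bar> \<le> 1"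
    using equitable_bipartite_two_coloring[OF finE', of "case_sum src id" "case_sum tgt id"] by blast
  define \<phi> where "\<phi> = \<psi> \<circ> Inl"
  have \<phi>1: "\<phi> e = 1 \<or> \<phi> e = -1" for e using \<psi>(1) by (simp add: \<phi>_def)
  have odd\<psi>: "odd (\<psi> e)" for e using \<psi>(1)[of e] by auto
  have "let D = (\<Sum>e\<in>E. \<phi> e * int (ends_at en e v)) in
      (odd (deg E en v) \<longrightarrow> \<bar>D\<bar> \<le> 1) \<and> (even (deg E en v) \<longrightarrow> \<bar>D\<bar> \<le> 2 \<and> 4 dvd D - int (deg E en v))" for v
  proof -
    define T H where "T = {e\<in>E. src e = v}" and "H = {e\<in>E. tgt e = v}"
    have finTH: "finite T" "finite H" using fin by (auto simp: T_def H_def)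
    have ea: "int (ends_at en e v) = of_bool (src e = v) + of_bool (tgt e = v)" for e
      using w(1)[of e] by (auto simp: ends_at_def src_def tgt_def)
    have D: "(\<Sum>e\<in>E. \<phi> e * int (ends_at en e v)) = sum \<phi> T + sum \<phi> H"
      unfolding T_def H_def using fin
      by (simp add: sum.inter_filter ea sum.distrib[symmetric]) (auto intro!: sum.cong)
    have "int (deg E en v) = int (card T) + int (card H)"
      unfolding T_def H_def deg_def using fin
      by (simp add: ea sum.distrib of_bool_def flip: sum.inter_filter)
    then have dTH: "deg E en v = card T + card H" by linarith
    have "(\<Sum>e\<in>E. w e * (of_bool (en e True = v) - of_bool (en e False = v))) =
      (\<Sum>e\<in>E. of_bool (src e = v) - of_bool (tgt e = v))"
      by (rule sum.cong) (use w(1) in \<open>auto simp: src_def tgt_def\<close>, (metis one_neq_neg_one)+)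
    also have "\<dots> = int (card T) - int (card H)" unfolding T_def H_def using fin
      by (simp add: sum_subtractf of_bool_def flip: sum.inter_filter)
    finally have diff: "\<bar>int (card T) - int (card H)\<bar> \<le> 1" using w(2)[of v] by simp
    have parT: "even (sum \<phi> T) \<longleftrightarrow> even (card T)" and parH: "even (sum \<phi> H) \<longleftrightarrow> even (card H)"
      using odd\<psi> finTH by (auto simp: \<phi>_def intro!: even_sum_signs)
    define a where "a = (if v \<in> L then \<psi> (Inr v) else 0)"
    have 1: "{e\<in>E'. case_sum src id e = v} = Inl ` T \<union> (if v \<in> L then {Inr v} else {})"
      and 2: "{e\<in>E'. case_sum tgt id e = v} = Inl ` H \<union> (if v \<in> L then {Inr v} else {})"
      by (auto simp: E'_def T_def H_def)
    have sT: "\<bar>sum \<phi> T + a\<bar> \<le> 1" using \<psi>(2)[of v] finTH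
      unfolding 1 a_def \<phi>_def by (auto simp: sum.reindex add.commute image_iff)
    have sH: "\<bar>sum \<phi> H + a\<bar> \<le> 1" using \<psi>(3)[of v] finTH
      unfolding 2 a_def \<phi>_def by (auto simp: sum.reindex add.commute image_iff)
    show ?thesis
    proof (cases "odd (deg E en v)")
      case True
      then have "a = 0" by (auto simp: a_def L_def)
      moreover have "even (card T) \<or> even (card H)" "odd (card T + card H)" using True dTH by auto
      ultimately have "\<bar>sum \<phi> T + sum \<phi> H\<bar> \<le> 1"
        using parT parH sT sH even_abs_le_1[of "sum \<phi> T"] even_abs_le_1[of "sum \<phi> H"] by auto
      then show ?thesis using True D by simp
    next
      case False
      then have "even (int (card T) - int (card H))" using dTH by simp
      then have eq: "card T = card H" using even_abs_le_1[OF _ diff] by simp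
      then have half: "deg E en v div 2 = card T" "deg E en v = 2 * card T" using dTH by auto
      show ?thesis
      proof (cases "even (card T)")
        case True
        then have "a = 0" by (auto simp: a_def L_def half)
        then have "sum \<phi> T = 0" "sum \<phi> H = 0"
          using parT parH sT sH True eq even_abs_le_1[of "sum \<phi> T"] even_abs_le_1[of "sum \<phi> H"] by auto
        then show ?thesis using D half True False by (auto simp: Let_def elim!: evenE)
      next
        case oddT: False
        then have "T \<noteq> {}" by auto
        then have "v \<in> L" using oddT half by (auto simp: L_def T_def)
        then have a: "a = 1 \<or> a = -1" using \<psi>(1) by (simp add: a_def)
        then have "sum \<phi> T = -a" "sum \<phi> H = -a"
          using parT parH sT sH oddT eq even_abs_le_1[of "sum \<phi> T + a"] even_abs_le_1[of "sum \<phi> H + a"] by auto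
        then have D': "(\<Sum>e\<in>E. \<phi> e * int (ends_at en e v)) = - 2 * a" using D by simp
        obtain n where "card T = 2 * n + 1" using oddT oddE by blast
        then have "- 2 * a - int (deg E en v) = 4 * (if a = 1 then - int n - 1 else - int n)"
          using a half(2) by auto
        then have "4 dvd - 2 * a - int (deg E en v)" by (metis dvd_triv_left)
        then show ?thesis unfolding D' Let_def using False a by auto
      qed
    qed
  qed
  then show ?thesis using \<phi>1 by blast
qed

text \<open>Here every half-edge carries a sign: in the application it is 1 in one colour class and -1 in the
  other, and \<open>\<phi> e = -1\<close> means that \<open>e\<close> changes its colour. Halves of opposite sign at a vertex
  cancel if their edges get the same value of \<open>\<phi>\<close>, so the two edges can be merged by a slide, which
  carries the sign of the far half along. When no such pair is left, all signs at a vertex agree and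
  \<open>balanced_signing\<close> applies.\<close>

lemma balanced_signed_signing:
  fixes en :: "'e \<Rightarrow> bool \<Rightarrow> 'v" and sg :: "'e \<Rightarrow> bool \<Rightarrow> int"
  assumes "finite E" and "\<forall>e\<in>E. \<forall>h. sg e h = 1 \<or> sg e h = -1"
  shows "\<exists>\<phi> :: 'e \<Rightarrow> int. (\<forall>e. \<phi> e = 1 \<or> \<phi> e = -1) \<and>
    (\<forall>v. let S0 = (\<Sum>e\<in>E. sg e False * of_bool (en e False = v) + sg e True * of_bool (en e True = v));
             S = (\<Sum>e\<in>E. \<phi> e * (sg e False * of_bool (en e False = v) + sg e True * of_bool (en e True = v))) in
      (odd S0 \<longrightarrow> \<bar>S\<bar> \<le> 1) \<and> (even S0 \<longrightarrow> \<bar>S\<bar> \<le> 2 \<and> 4 dvd S - S0))"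
  using assms
proof (induction "card E" arbitrary: E en sg rule: less_induct)
  case less
  note fin = less.prems(1)
  let ?c = "\<lambda>en sg e v. sg e False * of_bool (en e False = v) + sg e True * of_bool (en e True = v) :: int"
  consider (pair) f g i j where "f \<in> E" "g \<in> E" "f \<noteq> g" "en f i = en g j" "sg f i = - sg g j"
    | (loop) e where "e \<in> E" "en e False = en e True" "sg e False = - sg e True"
    | (uniform) "\<And>e g i j. e \<in> E \<Longrightarrow> g \<in> E \<Longrightarrow> en e i = en g j \<Longrightarrow> sg e i = sg g j"
  proof -
    have "sg e i = sg g j" if "e \<in> E" "g \<in> E" "en e i = en g j"
      "\<And>f g i j. f \<in> E \<Longrightarrow> g \<in> E \<Longrightarrow> f \<noteq> g \<Longrightarrow> en f i = en g j \<Longrightarrow> sg f i \<noteq> - sg g j"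
      "\<And>e. e \<in> E \<Longrightarrow> en e False = en e True \<Longrightarrow> sg e False \<noteq> - sg e True" for e g i j
    proof -
      have "sg e i = 1 \<or> sg e i = -1" "sg g j = 1 \<or> sg g j = -1" using less.prems that by blast+
      moreover have "sg e i \<noteq> - sg g j" if "e \<noteq> g" using that \<open>e \<in> E\<close> \<open>g \<in> E\<close> \<open>en e i = en g j\<close> \<open>\<And>f g i j. f \<in> E \<Longrightarrow> g \<in> E \<Longrightarrow> f \<noteq> g \<Longrightarrow> en f i = en g j \<Longrightarrow> sg f i \<noteq> - sg g j\<close> by blast
      moreover have "sg e i \<noteq> - sg g j" if "e = g" "i \<noteq> j"
        using that \<open>e \<in> E\<close> \<open>en e i = en g j\<close> \<open>\<And>e. e \<in> E \<Longrightarrow> en e False = en e True \<Longrightarrow> sg e False \<noteq> - sg e True\<close>[of e]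
        by (cases i; cases j) auto
      ultimately show ?thesis by (cases "e = g"; cases "i = j") auto
    qed
    then show ?thesis using that by blast
  qed
  then show ?case
  proof cases
    case pair
    let ?en = "slide en f i g j" and ?sg = "slide sg f i g j"
    have "card (E - {f}) < card E" using fin pair by (meson card_Diff1_less)
    moreover have "\<forall>e\<in>E - {f}. \<forall>h. ?sg e h = 1 \<or> ?sg e h = -1"
      using less.prems(2) pair by (auto simp: slide_def)
    ultimately obtain \<phi> :: "'e \<Rightarrow> int" where \<phi>: "\<forall>e. \<phi> e = 1 \<or> \<phi> e = -1"
      "\<forall>v. let S0 = (\<Sum>e\<in>E - {f}. ?c ?en ?sg e v); S = (\<Sum>e\<in>E - {f}. \<phi> e * ?c ?en ?sg e v) in
        (odd S0 \<longrightarrow> \<bar>S\<bar> \<le> 1) \<and> (even S0 \<longrightarrow> \<bar>S\<bar> \<le> 2 \<and> 4 dvd S - S0)"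
      using less.hyps[of "E - {f}" ?sg ?en] fin by blast
    let ?\<phi> = "\<phi>(f := \<phi> g)"
    have E: "E = insert f (insert g (E - {f, g}))" "E - {f} = insert g (E - {f, g})" using pair by auto
    have S: "(\<Sum>e\<in>E. \<chi>' e * ?c en sg e v) = (\<Sum>e\<in>E - {f}. \<chi> e * ?c ?en ?sg e v)"
      if "\<And>e. e \<noteq> f \<Longrightarrow> \<chi>' e = \<chi> e" "\<chi>' f = \<chi> g" for \<chi> \<chi>' :: "'e \<Rightarrow> int" and v
    proof -
      have rest: "(\<Sum>e\<in>E - {f, g}. \<chi>' e * ?c en sg e v) = (\<Sum>e\<in>E - {f, g}. \<chi> e * ?c ?en ?sg e v)"
        using that(1) by (intro sum.cong) (auto simp: slide_def)
      show ?thesis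
        apply (subst E(1), subst E(2))
        using fin pair rest that
        by (cases i; cases j) (auto simp: slide_def algebra_simps)
    qed
    have S0: "(\<Sum>e\<in>E. ?c en sg e v) = (\<Sum>e\<in>E - {f}. ?c ?en ?sg e v)" for v
      using S[of "\<lambda>_. 1" "\<lambda>_. 1" v] by simp
    have S1: "(\<Sum>e\<in>E. ?\<phi> e * ?c en sg e v) = (\<Sum>e\<in>E - {f}. \<phi> e * ?c ?en ?sg e v)" for v
      by (rule S) auto
    have "\<forall>e. ?\<phi> e = 1 \<or> ?\<phi> e = -1" using \<phi>(1) by auto
    then show ?thesis by (intro exI[of _ ?\<phi>] conjI) (assumption, unfold S0 S1, rule \<phi>(2))
  next
    case loop
    have "card (E - {e}) < card E" using fin loop by (meson card_Diff1_less)
    then obtain \<phi> :: "'e \<Rightarrow> int" where \<phi>: "\<forall>e. \<phi> e = 1 \<or> \<phi> e = -1"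
      "\<forall>v. let S0 = (\<Sum>e\<in>E - {e}. ?c en sg e v); S = (\<Sum>e\<in>E - {e}. \<phi> e * ?c en sg e v) in
        (odd S0 \<longrightarrow> \<bar>S\<bar> \<le> 1) \<and> (even S0 \<longrightarrow> \<bar>S\<bar> \<le> 2 \<and> 4 dvd S - S0)"
      using less.hyps[of "E - {e}" sg en] less.prems by blast
    have "(\<Sum>e\<in>E. \<chi> e * ?c en sg e v) = (\<Sum>e\<in>E - {e}. \<chi> e * ?c en sg e v)" for \<chi> v
      using fin loop by (subst sum.remove[of E e]) auto
    from this[of \<phi>] this[of "\<lambda>_. 1"] show ?thesis using \<phi> by (intro exI[of _ \<phi>]) simp
  next
    case uniform
    obtain \<phi> :: "'e \<Rightarrow> int" where \<phi>: "\<And>e. \<phi> e = 1 \<or> \<phi> e = -1"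
      "\<And>v. let D = (\<Sum>e\<in>E. \<phi> e * int (ends_at en e v)) in
      (odd (deg E en v) \<longrightarrow> \<bar>D\<bar> \<le> 1) \<and> (even (deg E en v) \<longrightarrow> \<bar>D\<bar> \<le> 2 \<and> 4 dvd D - int (deg E en v))"
      using balanced_signing[OF fin, of en] by blast
    have "let S0 = (\<Sum>e\<in>E. ?c en sg e v); S = (\<Sum>e\<in>E. \<phi> e * ?c en sg e v) in
        (odd S0 \<longrightarrow> \<bar>S\<bar> \<le> 1) \<and> (even S0 \<longrightarrow> \<bar>S\<bar> \<le> 2 \<and> 4 dvd S - S0)" for v
    proof -
      obtain \<sigma> where \<sigma>: "\<sigma> = 1 \<or> \<sigma> = (-1::int)" "\<And>e h. e \<in> E \<Longrightarrow> en e h = v \<Longrightarrow> sg e h = \<sigma>"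
      proof (cases "\<exists>e\<in>E. \<exists>h. en e h = v")
        case True
        then obtain e h where "e \<in> E" "en e h = v" by blast
        then show ?thesis using that[of "sg e h"] uniform less.prems(2) by blast
      next
        case False
        then show ?thesis using that[of 1] by blast
      qed
      have c: "?c en sg e v = \<sigma> * int (ends_at en e v)" if "e \<in> E" for e
        using \<sigma>(2)[OF that] by (auto simp: ends_at_def)
      have S: "(\<Sum>e\<in>E. ?c en sg e v) = \<sigma> * int (deg E en v)"
        "(\<Sum>e\<in>E. \<phi> e * ?c en sg e v) = \<sigma> * (\<Sum>e\<in>E. \<phi> e * int (ends_at en e v))"
        by (simp_all add: c deg_def sum_distrib_left mult.left_commute)
      have "4 dvd \<sigma> * D - \<sigma> * int n" if "4 dvd D - int n" for D n
        using that by (metis dvd_mult right_diff_distrib)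
      then show ?thesis unfolding S using \<phi>(2)[of v] \<sigma>(1) by (auto simp: Let_def abs_mult)
    qed
    then show ?thesis using \<phi>(1) by blast
  qed
qed

text \<open>If any two colours can be balanced against each other without affecting the rest, then all pairs
  can be balanced at once: a colouring that minimises the sum of the squares of all colour degrees is
  balanced, since with a fixed sum of two degrees the sum of their squares decreases with their difference.
  The predicate \<open>I\<close> is an invariant that the recolouring has to preserve.\<close>

lemma pairwise_balanced_coloring:
  fixes w :: "'x \<Rightarrow> 'e \<Rightarrow> nat" and b :: int
  defines "d \<equiv> \<lambda>E c i x. \<Sum>e\<in>{e\<in>E. c e = i}. w x e"
  assumes fin: "finite E" "finite X" "finite C" and c0: "I c0"
    and ran: "\<And>c e. I c \<Longrightarrow> e \<in> E \<Longrightarrow> c e \<in> C"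
    and step: "\<And>c i j. I c \<Longrightarrow> i \<in> C \<Longrightarrow> j \<in> C \<Longrightarrow> i \<noteq> j \<Longrightarrow>
      \<exists>c'. I c' \<and> (\<forall>e\<in>E. c e \<noteq> i \<and> c e \<noteq> j \<longrightarrow> c' e = c e) \<and> (\<forall>e\<in>E. c e = i \<or> c e = j \<longrightarrow> c' e = i \<or> c' e = j) \<and>
        (\<forall>x\<in>X. \<bar>int (d E c' i x) - int (d E c' j x)\<bar> \<le> min b \<bar>int (d E c i x) - int (d E c j x)\<bar>)"
  shows "\<exists>c. I c \<and> (\<forall>x\<in>X. \<forall>i\<in>C. \<forall>j\<in>C. \<bar>int (d E c i x) - int (d E c j x)\<bar> \<le> b \<or> i = j)"
proof -
  define M where "M = (\<lambda>c. \<Sum>x\<in>X. \<Sum>i\<in>C. (d E c i x)\<^sup>2)"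
  obtain c where c: "I c" "\<And>c'. I c' \<Longrightarrow> M c \<le> M c'"
    using ex_has_least_nat[of I c0 M] c0 by blast
  have "\<bar>int (d E c i x) - int (d E c j x)\<bar> \<le> b" if x: "x \<in> X" and ij: "i \<in> C" "j \<in> C" "i \<noteq> j" for x i j
  proof (rule ccontr)
    assume viol: "\<not> ?thesis"
    obtain c' where c': "I c'" "\<forall>e\<in>E. c e \<noteq> i \<and> c e \<noteq> j \<longrightarrow> c' e = c e" "\<forall>e\<in>E. c e = i \<or> c e = j \<longrightarrow> c' e = i \<or> c' e = j"
      "\<forall>x\<in>X. \<bar>int (d E c' i x) - int (d E c' j x)\<bar> \<le> min b \<bar>int (d E c i x) - int (d E c j x)\<bar>"
      using step[OF c(1) ij] by blast
    have split: "(\<Sum>l\<in>C. (d E c l y)\<^sup>2) = (d E c i y)\<^sup>2 + (d E c j y)\<^sup>2 + (\<Sum>l\<in>C - {i, j}. (d E c l y)\<^sup>2)" for c y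
    proof -
      have "C = insert i (insert j (C - {i, j}))" using ij by auto
      then show ?thesis using fin(3) ij(3) by (metis (no_types, lifting) Diff_iff add.assoc finite_Diff finite_insert insertE insertI1 insert_Diff_if insert_commute sum.insert)
    qed
    have other: "d E c' l y = d E c l y" if "l \<in> C - {i, j}" for l y
    proof -
      have "{e \<in> E. c' e = l} = {e \<in> E. c e = l}" using that c'(2,3) by fastforce
      then show ?thesis by (simp add: d_def)
    qed
    have pair: "d E c i y + d E c j y = (\<Sum>e\<in>{e\<in>E. c e = i \<or> c e = j}. w y e)" for c y
    proof -
      have "{e\<in>E. c e = i \<or> c e = j} = {e\<in>E. c e = i} \<union> {e\<in>E. c e = j}" by auto
      then show ?thesis unfolding d_def using fin(1) ij(3) by (subst sum.union_disjoint[symmetric]) auto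
    qed
    have "{e\<in>E. c' e = i \<or> c' e = j} = {e\<in>E. c e = i \<or> c e = j}" using c'(2,3) by fastforce
    then have same: "d E c' i y + d E c' j y = d E c i y + d E c j y" for y by (simp add: pair)
    have sq: "2 * int (m\<^sup>2 + n\<^sup>2) = (int (m + n))\<^sup>2 + \<bar>int m - int n\<bar>\<^sup>2" for m n :: nat
      by (simp add: power2_eq_square algebra_simps)
    have le: "(d E c' i y)\<^sup>2 + (d E c' j y)\<^sup>2 \<le> (d E c i y)\<^sup>2 + (d E c j y)\<^sup>2" if "y \<in> X" for y
    proof -
      have "\<bar>int (d E c' i y) - int (d E c' j y)\<bar>\<^sup>2 \<le> \<bar>int (d E c i y) - int (d E c j y)\<bar>\<^sup>2"
        using c'(4) that by (intro power_mono) auto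
      then have "2 * int ((d E c' i y)\<^sup>2 + (d E c' j y)\<^sup>2) \<le> 2 * int ((d E c i y)\<^sup>2 + (d E c j y)\<^sup>2)"
        unfolding sq same by (rule add_left_mono)
      then show ?thesis by (simp only: mult_le_cancel_left_pos zero_less_numeral of_nat_le_iff)
    qed
    have lt: "(d E c' i x)\<^sup>2 + (d E c' j x)\<^sup>2 < (d E c i x)\<^sup>2 + (d E c j x)\<^sup>2"
    proof -
      have "\<bar>int (d E c' i x) - int (d E c' j x)\<bar> < \<bar>int (d E c i x) - int (d E c j x)\<bar>"
        using c'(4) x viol by fastforce
      then have "\<bar>int (d E c' i x) - int (d E c' j x)\<bar>\<^sup>2 < \<bar>int (d E c i x) - int (d E c j x)\<bar>\<^sup>2"
        by (intro power_strict_mono) auto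
      then have "2 * int ((d E c' i x)\<^sup>2 + (d E c' j x)\<^sup>2) < 2 * int ((d E c i x)\<^sup>2 + (d E c j x)\<^sup>2)"
        unfolding sq same by (rule add_strict_left_mono)
      then show ?thesis by (simp only: mult_less_cancel_left_pos zero_less_numeral of_nat_less_iff)
    qed
    have "M c' < M c" unfolding M_def
    proof (rule sum_strict_mono_ex1[OF fin(2)])
      show "\<forall>y\<in>X. (\<Sum>i\<in>C. (d E c' i y)\<^sup>2) \<le> (\<Sum>i\<in>C. (d E c i y)\<^sup>2)"
        using le other by (simp add: split)
      show "\<exists>y\<in>X. (\<Sum>i\<in>C. (d E c' i y)\<^sup>2) < (\<Sum>i\<in>C. (d E c i y)\<^sup>2)"
        using lt other x by (intro bexI[of _ x]) (simp_all add: split)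
    qed
    then show False using c(2)[OF c'(1)] by simp
  qed
  then show ?thesis using c(1) by blast
qed

lemma color_difference:
  fixes w :: "'e \<Rightarrow> nat"
  assumes "finite E" "i \<noteq> j"
  shows "int (\<Sum>e\<in>{e\<in>E. c e = i}. w e) - int (\<Sum>e\<in>{e\<in>E. c e = j}. w e) =
    (\<Sum>e\<in>{e\<in>E. c e = i \<or> c e = j}. (if c e = i then 1 else -1) * int (w e))"
proof -
  let ?g = "\<lambda>e. (if c e = i then 1 else -1) * int (w e)"
  have eq: "{e\<in>E. c e = i \<or> c e = j} = {e\<in>E. c e = i} \<union> {e\<in>E. c e = j}" by auto
  have "sum ?g {e\<in>E. c e = i \<or> c e = j} = sum ?g {e\<in>E. c e = i} + sum ?g {e\<in>E. c e = j}"
    unfolding eq using assms by (intro sum.union_disjoint) auto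
  moreover have "sum ?g {e\<in>E. c e = i} = int (\<Sum>e\<in>{e\<in>E. c e = i}. w e)"
    unfolding of_nat_sum by (rule sum.cong) auto
  moreover have "sum ?g {e\<in>E. c e = j} = - int (\<Sum>e\<in>{e\<in>E. c e = j}. w e)"
    unfolding of_nat_sum sum_negf[symmetric] by (rule sum.cong) (use assms(2) in auto)
  ultimately show ?thesis by linarith
qed

text \<open>Exchanging \<open>i\<close> and \<open>j\<close> on the edges where \<open>\<phi>\<close> is -1 multiplies their contributions by \<open>\<phi>\<close>.\<close>

lemma recolored_difference:
  fixes w :: "'e \<Rightarrow> nat" and \<phi> :: "'e \<Rightarrow> int" and c :: "'e \<Rightarrow> 'c"
  assumes "finite E" "i \<noteq> j" and \<phi>: "\<forall>e. \<phi> e = 1 \<or> \<phi> e = -1"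
  defines "c' \<equiv> \<lambda>e. if \<phi> e = 1 then c e else if c e = i then j else if c e = j then i else c e"
  shows "int (\<Sum>e\<in>{e\<in>E. c' e = i}. w e) - int (\<Sum>e\<in>{e\<in>E. c' e = j}. w e) =
    (\<Sum>e\<in>{e\<in>E. c e = i \<or> c e = j}. \<phi> e * ((if c e = i then 1 else -1) * int (w e)))"
proof -
  have eq: "{e\<in>E. c' e = i \<or> c' e = j} = {e\<in>E. c e = i \<or> c e = j}" by (auto simp: c'_def)
  show ?thesis unfolding color_difference[OF assms(1,2)] eq
  proof (rule sum.cong)
    fix e assume "e \<in> {e\<in>E. c e = i \<or> c e = j}"
    then show "(if c' e = i then 1 else -1) * int (w e) = \<phi> e * ((if c e = i then 1 else -1) * int (w e))"
      using \<phi>[rule_format, of e] assms(2) by (auto simp: c'_def)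
  qed simp
qed

section \<open>Equitable colourings of bipartite graphs\<close>

lemma equitable_bipartite_coloring:
  fixes l :: "'e \<Rightarrow> 'a" and r :: "'e \<Rightarrow> 'b" and C :: "'c set"
  assumes fin: "finite E" "finite C" and "C \<noteq> {}"
  shows "\<exists>c. (\<forall>e\<in>E. c e \<in> C) \<and>
    (\<forall>x. \<forall>i\<in>C. \<forall>j\<in>C. card {e\<in>E. c e = i \<and> l e = x} \<le> card {e\<in>E. c e = j \<and> l e = x} + 1) \<and>
    (\<forall>y. \<forall>i\<in>C. \<forall>j\<in>C. card {e\<in>E. c e = i \<and> r e = y} \<le> card {e\<in>E. c e = j \<and> r e = y} + 1)"
proof -
  define w :: "'a + 'b \<Rightarrow> 'e \<Rightarrow> nat" where "w = (\<lambda>x e. of_bool (case x of Inl a \<Rightarrow> l e = a | Inr b \<Rightarrow> r e = b))"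
  define X where "X = Inl ` l ` E \<union> Inr ` r ` E"
  have finX: "finite X" using fin by (simp add: X_def)
  obtain i0 where "i0 \<in> C" using assms(3) by blast
  have "\<exists>c. (\<forall>e\<in>E. c e \<in> C) \<and> (\<forall>x\<in>X. \<forall>i\<in>C. \<forall>j\<in>C.
    \<bar>int (\<Sum>e\<in>{e\<in>E. c e = i}. w x e) - int (\<Sum>e\<in>{e\<in>E. c e = j}. w x e)\<bar> \<le> 1 \<or> i = j)"
  proof (rule pairwise_balanced_coloring[OF fin(1) finX fin(2)])
    show "\<forall>e\<in>E. (\<lambda>_. i0) e \<in> C" using \<open>i0 \<in> C\<close> by simp
    show "\<forall>e\<in>E. c e \<in> C \<Longrightarrow> e \<in> E \<Longrightarrow> c e \<in> C" for c :: "'e \<Rightarrow> 'c" and e by blast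
    fix c :: "'e \<Rightarrow> 'c" and i j
    assume c: "\<forall>e\<in>E. c e \<in> C" and ij: "i \<in> C" "j \<in> C" "i \<noteq> j"
    let ?E = "{e\<in>E. c e = i \<or> c e = j}"
    have finE': "finite ?E" using fin(1) by simp
    obtain \<phi> :: "'e \<Rightarrow> int" where \<phi>: "\<forall>e. \<phi> e = 1 \<or> \<phi> e = -1"
      "\<forall>x. \<bar>\<Sum>e\<in>{e\<in>?E. l e = x}. \<phi> e\<bar> \<le> 1" "\<forall>y. \<bar>\<Sum>e\<in>{e\<in>?E. r e = y}. \<phi> e\<bar> \<le> 1"
      using equitable_bipartite_two_coloring[of ?E l r] fin(1) by auto
    \<comment> \<open>\<open>\<phi>\<close> prescribes the new colour, 1 meaning \<open>i\<close>, while \<open>\<psi>\<close> says whether the colour is kept.\<close>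
    define \<psi> where "\<psi> = (\<lambda>e. if c e = i then \<phi> e else - \<phi> e)"
    have \<psi>: "\<forall>e. \<psi> e = 1 \<or> \<psi> e = -1" using \<phi>(1) by (auto simp: \<psi>_def)
    define c' where "c' = (\<lambda>e. if \<psi> e = 1 then c e else if c e = i then j else if c e = j then i else c e)"
    have diff: "int (\<Sum>e\<in>{e\<in>E. c' e = i}. w x e) - int (\<Sum>e\<in>{e\<in>E. c' e = j}. w x e) = (\<Sum>e\<in>?E. \<phi> e * int (w x e))" for x
      unfolding c'_def recolored_difference[OF fin(1) ij(3) \<psi>]
      by (rule sum.cong) (use ij(3) in \<open>auto simp: \<psi>_def\<close>)
    have le1: "\<bar>\<Sum>e\<in>?E. \<phi> e * int (w x e)\<bar> \<le> 1" for x
    proof (cases x)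
      case (Inl a)
      have "(\<Sum>e\<in>{e\<in>?E. l e = a}. \<phi> e) = (\<Sum>e\<in>?E. \<phi> e * int (w x e))"
        unfolding sum.inter_filter[OF finE', of \<phi> "\<lambda>e. l e = a"] by (rule sum.cong) (auto simp: w_def Inl)
      then show ?thesis using \<phi>(2)[rule_format, of a] by (simp only:)
    next
      case (Inr b)
      have "(\<Sum>e\<in>{e\<in>?E. r e = b}. \<phi> e) = (\<Sum>e\<in>?E. \<phi> e * int (w x e))"
        unfolding sum.inter_filter[OF finE', of \<phi> "\<lambda>e. r e = b"] by (rule sum.cong) (auto simp: w_def Inr)
      then show ?thesis using \<phi>(3)[rule_format, of b] by (simp only:)
    qed
    have odd\<phi>: "odd (\<phi> e)" for e using \<phi>(1)[rule_format, of e] by auto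
    have par: "even (\<Sum>e\<in>?E. \<phi> e * int (w x e)) \<longleftrightarrow> even (int (\<Sum>e\<in>{e\<in>E. c e = i}. w x e) - int (\<Sum>e\<in>{e\<in>E. c e = j}. w x e))" for x
    proof -
      have "even ((\<Sum>e\<in>?E. \<phi> e * int (w x e)) - (\<Sum>e\<in>?E. (if c e = i then 1 else -1) * int (w x e)))"
        unfolding sum_subtractf[symmetric] using odd\<phi> by (intro dvd_sum) auto
      then show ?thesis unfolding color_difference[OF fin(1) ij(3)] by simp
    qed
    have "\<bar>\<Sum>e\<in>?E. \<phi> e * int (w x e)\<bar> \<le> min 1 \<bar>int (\<Sum>e\<in>{e\<in>E. c e = i}. w x e) - int (\<Sum>e\<in>{e\<in>E. c e = j}. w x e)\<bar>" for x
    proof (cases "int (\<Sum>e\<in>{e\<in>E. c e = i}. w x e) - int (\<Sum>e\<in>{e\<in>E. c e = j}. w x e) = 0")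
      case True
      then have "even (\<Sum>e\<in>?E. \<phi> e * int (w x e))" using par[of x] by simp
      then show ?thesis using even_abs_le_1[OF _ le1[of x]] by simp
    next
      case False
      then show ?thesis using le1[of x] by linarith
    qed
    then show "\<exists>c'. (\<forall>e\<in>E. c' e \<in> C) \<and> (\<forall>e\<in>E. c e \<noteq> i \<and> c e \<noteq> j \<longrightarrow> c' e = c e) \<and>
      (\<forall>e\<in>E. c e = i \<or> c e = j \<longrightarrow> c' e = i \<or> c' e = j) \<and>
      (\<forall>x\<in>X. \<bar>int (\<Sum>e\<in>{e\<in>E. c' e = i}. w x e) - int (\<Sum>e\<in>{e\<in>E. c' e = j}. w x e)\<bar> \<le>
        min 1 \<bar>int (\<Sum>e\<in>{e\<in>E. c e = i}. w x e) - int (\<Sum>e\<in>{e\<in>E. c e = j}. w x e)\<bar>)"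
      using c ij diff by (intro exI[of _ c'] conjI) (auto simp: c'_def)
  qed
  then obtain c where c: "\<forall>e\<in>E. c e \<in> C" "\<And>x i j. x \<in> X \<Longrightarrow> i \<in> C \<Longrightarrow> j \<in> C \<Longrightarrow>
    \<bar>int (\<Sum>e\<in>{e\<in>E. c e = i}. w x e) - int (\<Sum>e\<in>{e\<in>E. c e = j}. w x e)\<bar> \<le> 1 \<or> i = j" by blast
  have wl: "(\<Sum>e\<in>{e\<in>E. c e = i}. w (Inl x) e) = card {e\<in>E. c e = i \<and> l e = x}" for i x
  proof -
    have "{e\<in>{e\<in>E. c e = i}. l e = x} = {e\<in>E. c e = i \<and> l e = x}" by auto
    then show ?thesis using fin(1) by (simp add: w_def of_bool_def flip: sum.inter_filter)
  qed
  have wr: "(\<Sum>e\<in>{e\<in>E. c e = i}. w (Inr x) e) = card {e\<in>E. c e = i \<and> r e = x}" for i x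
  proof -
    have "{e\<in>{e\<in>E. c e = i}. r e = x} = {e\<in>E. c e = i \<and> r e = x}" by auto
    then show ?thesis using fin(1) by (simp add: w_def of_bool_def flip: sum.inter_filter)
  qed
  have "card {e\<in>E. c e = i \<and> l e = x} \<le> card {e\<in>E. c e = j \<and> l e = x} + 1" if "i \<in> C" "j \<in> C" for i j x
  proof (cases "x \<in> l ` E")
    case True
    then show ?thesis using c(2)[of "Inl x" i j] that unfolding wl by (auto simp: X_def)
  next
    case False
    then have empty: "{e\<in>E. c e = i \<and> l e = x} = {}" by auto
    show ?thesis unfolding empty by simp
  qed
  moreover have "card {e\<in>E. c e = i \<and> r e = x} \<le> card {e\<in>E. c e = j \<and> r e = x} + 1" if "i \<in> C" "j \<in> C" for i j x
  proof (cases "x \<in> r ` E")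
    case True
    then show ?thesis using c(2)[of "Inr x" i j] that unfolding wr by (auto simp: X_def)
  next
    case False
    then have empty: "{e\<in>E. c e = i \<and> r e = x} = {}" by auto
    show ?thesis unfolding empty by simp
  qed
  ultimately show ?thesis using c(1) by blast
qed

section \<open>Balanced colourings with few even degrees\<close>

text \<open>For degrees \<open>a\<close>, \<open>b\<close> in two colours and new degrees \<open>a'\<close>, \<open>b'\<close> with the same sum, the
  difference modulo 4 determines the parities of \<open>a'\<close> and \<open>b'\<close>.\<close>

lemma balanced_pair:
  fixes a b a' b' :: int
  assumes bal: "(odd (a - b) \<longrightarrow> \<bar>a' - b'\<bar> \<le> 1) \<and> (even (a - b) \<longrightarrow> \<bar>a' - b'\<bar> \<le> 2 \<and> 4 dvd (a' - b') - (a - b))"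
    and tot: "a' + b' = a + b"
  shows "\<bar>a' - b'\<bar> \<le> min 2 \<bar>a - b\<bar>"
    and "even (a - b) \<Longrightarrow> even a' \<longleftrightarrow> even a" and "even (a - b) \<Longrightarrow> even b' \<longleftrightarrow> even b"
proof -
  show "even a' \<longleftrightarrow> even a" "even b' \<longleftrightarrow> even b" if "even (a - b)"
  proof -
    have "4 dvd (a' - b') - (a - b)" using bal that by (simp only:)
    then obtain q where "(a' - b') - (a - b) = 4 * q" by (rule dvdE)
    then have "a' = a + 2 * q" "b' = b - 2 * q" using tot by linarith+
    then show "even a' \<longleftrightarrow> even a" "even b' \<longleftrightarrow> even b" by simp_all
  qed
  show "\<bar>a' - b'\<bar> \<le> min 2 \<bar>a - b\<bar>"
  proof (cases "odd (a - b)")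
    case True
    then have "a - b \<noteq> 0" by auto
    then show ?thesis using bal True by auto
  next
    case False
    then have even: "even (a - b)" by blast
    have le: "\<bar>a' - b'\<bar> \<le> 2" and dv: "4 dvd (a' - b') - (a - b)" using bal even by (simp_all only:)
    obtain q where "(a' - b') - (a - b) = 4 * q" using dv by (rule dvdE)
    moreover obtain r where "a - b = 2 * r" using even by (rule evenE)
    ultimately have d: "a' - b' = 2 * r + 4 * q" "a - b = 2 * r" by linarith+
    then have "r = 0 \<Longrightarrow> q = 0" using le by presburger
    then show ?thesis using le unfolding d by (cases "r = 0") auto
  qed
qed

lemma even_int_diff: "even (m + n) \<Longrightarrow> even (int m - int n)"
  by simp

text \<open>Balancing two colours keeps, at each vertex, how many of the two degrees are even: if their sum
  is odd there is one before and after, and if it is even both parities are preserved. Hence having at most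
  one even colour degree is invariant.\<close>

lemma parity_balanced_coloring:
  fixes en :: "'e \<Rightarrow> bool \<Rightarrow> 'v" and C :: "'c set"
  assumes fin: "finite E" "finite V" "finite C"
    and c0: "\<forall>e\<in>E. c0 e \<in> C"
    and P: "\<forall>v\<in>P. \<forall>i\<in>C. \<forall>j\<in>C. i \<noteq> j \<longrightarrow> odd (deg {e\<in>E. c0 e = i} en v) \<or> odd (deg {e\<in>E. c0 e = j} en v)"
    and "P \<subseteq> V"
  shows "\<exists>c. (\<forall>e\<in>E. c e \<in> C) \<and>
    (\<forall>v\<in>P. \<forall>i\<in>C. \<forall>j\<in>C. i \<noteq> j \<longrightarrow> odd (deg {e\<in>E. c e = i} en v) \<or> odd (deg {e\<in>E. c e = j} en v)) \<and>
    (\<forall>v\<in>V. \<forall>i\<in>C. \<forall>j\<in>C. deg {e\<in>E. c e = i} en v \<le> deg {e\<in>E. c e = j} en v + 2)"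
proof -
  let ?d = "\<lambda>c i v. \<Sum>e\<in>{e\<in>E. c e = i}. ends_at en e v"
  let ?I = "\<lambda>c. (\<forall>e\<in>E. c e \<in> C) \<and> (\<forall>v\<in>P. \<forall>i\<in>C. \<forall>j\<in>C. i \<noteq> j \<longrightarrow> odd (?d c i v) \<or> odd (?d c j v))"
  have "\<exists>c. ?I c \<and> (\<forall>v\<in>V. \<forall>i\<in>C. \<forall>j\<in>C. \<bar>int (?d c i v) - int (?d c j v)\<bar> \<le> 2 \<or> i = j)"
  proof (rule pairwise_balanced_coloring[OF fin])
    show "?I c0" using c0 P by (simp add: deg_def)
    show "?I c \<Longrightarrow> e \<in> E \<Longrightarrow> c e \<in> C" for c e by blast
    fix c i j
    assume c: "?I c" and ij: "i \<in> C" "j \<in> C" "i \<noteq> j"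
    let ?E = "{e\<in>E. c e = i \<or> c e = j}"
    have finE': "finite ?E" using fin(1) by simp
    define sg :: "'e \<Rightarrow> bool \<Rightarrow> int" where "sg = (\<lambda>e _. if c e = i then 1 else -1)"
    have "\<forall>e\<in>?E. \<forall>h. sg e h = 1 \<or> sg e h = -1" by (simp add: sg_def)
    from balanced_signed_signing[OF finE' this, of en] obtain \<phi> :: "'e \<Rightarrow> int" where \<phi>: "\<forall>e. \<phi> e = 1 \<or> \<phi> e = -1"
      "\<And>v. let S0 = (\<Sum>e\<in>?E. sg e False * of_bool (en e False = v) + sg e True * of_bool (en e True = v));
             S = (\<Sum>e\<in>?E. \<phi> e * (sg e False * of_bool (en e False = v) + sg e True * of_bool (en e True = v))) in
      (odd S0 \<longrightarrow> \<bar>S\<bar> \<le> 1) \<and> (even S0 \<longrightarrow> \<bar>S\<bar> \<le> 2 \<and> 4 dvd S - S0)"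
      by blast
    define c' where "c' = (\<lambda>e. if \<phi> e = 1 then c e else if c e = i then j else if c e = j then i else c e)"
    have sg: "sg e False * of_bool (en e False = v) + sg e True * of_bool (en e True = v) =
      (if c e = i then 1 else -1) * int (ends_at en e v)" for e v
      by (auto simp: sg_def ends_at_def)
    have S: "int (?d c i v) - int (?d c j v) = (\<Sum>e\<in>?E. sg e False * of_bool (en e False = v) + sg e True * of_bool (en e True = v))"
      "int (?d c' i v) - int (?d c' j v) = (\<Sum>e\<in>?E. \<phi> e * (sg e False * of_bool (en e False = v) + sg e True * of_bool (en e True = v)))" for v
      unfolding sg c'_def using color_difference[OF fin(1) ij(3)] recolored_difference[OF fin(1) ij(3) \<phi>(1)] by auto
    have bal: "(odd (int (?d c i v) - int (?d c j v)) \<longrightarrow> \<bar>int (?d c' i v) - int (?d c' j v)\<bar> \<le> 1) \<and>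
      (even (int (?d c i v) - int (?d c j v)) \<longrightarrow> \<bar>int (?d c' i v) - int (?d c' j v)\<bar> \<le> 2 \<and>
         4 dvd (int (?d c' i v) - int (?d c' j v)) - (int (?d c i v) - int (?d c j v)))" for v
      unfolding S using \<phi>(2)[of v] unfolding Let_def .
    have other: "?d c' l v = ?d c l v" if "l \<noteq> i" "l \<noteq> j" for l v
    proof -
      have "{e \<in> E. c' e = l} = {e \<in> E. c e = l}" using that by (auto simp: c'_def)
      then show ?thesis by simp
    qed
    have union: "?d c i v + ?d c j v = (\<Sum>e\<in>{e\<in>E. c e = i \<or> c e = j}. ends_at en e v)" for c v
    proof -
      have "{e\<in>E. c e = i \<or> c e = j} = {e\<in>E. c e = i} \<union> {e\<in>E. c e = j}" by auto
      then show ?thesis using fin(1) ij(3) by (subst sum.union_disjoint[symmetric]) auto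
    qed
    have "{e\<in>E. c' e = i \<or> c' e = j} = ?E" by (auto simp: c'_def)
    then have total: "?d c' i v + ?d c' j v = ?d c i v + ?d c j v" for v by (simp add: union)
    have tot: "int (?d c' i v) + int (?d c' j v) = int (?d c i v) + int (?d c j v)" for v
      by (simp only: of_nat_add[symmetric] total)
    have bound: "\<bar>int (?d c' i v) - int (?d c' j v)\<bar> \<le> min 2 \<bar>int (?d c i v) - int (?d c j v)\<bar>" for v
      by (rule balanced_pair(1)[OF bal tot])
    have par: "even (?d c' i v) \<longleftrightarrow> even (?d c i v)" "even (?d c' j v) \<longleftrightarrow> even (?d c j v)"
      if "even (?d c i v + ?d c j v)" for v
    proof -
      have "even (int (?d c i v) - int (?d c j v))" using that by (rule even_int_diff)
      from balanced_pair(2,3)[OF bal tot this] show "even (?d c' i v) \<longleftrightarrow> even (?d c i v)" "even (?d c' j v) \<longleftrightarrow> even (?d c j v)"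
        by (simp_all only: even_of_nat)
    qed
    have "odd (?d c' k v) \<or> odd (?d c' l v)" if v: "v \<in> P" and kl: "k \<in> C" "l \<in> C" "k \<noteq> l" for v k l
    proof -
      have odd: "odd (?d c k v) \<or> odd (?d c l v)" if "k \<in> C" "l \<in> C" "k \<noteq> l" for k l using c v that by blast
      have ij': "odd (?d c' i v) \<or> odd (?d c' j v)"
      proof (cases "even (?d c i v + ?d c j v)")
        case True
        show ?thesis using odd[OF ij] unfolding par[OF True] .
      next
        case False
        then have "odd (?d c' i v + ?d c' j v)" unfolding total .
        then show ?thesis unfolding even_add by blast
      qed
      have one: "odd (?d c' m v) \<or> odd (?d c' l v)" if "l \<in> C" "l \<noteq> i" "l \<noteq> j" "m = i \<or> m = j" for l m
      proof (cases "odd (?d c l v)")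
        case False
        then have odds: "odd (?d c i v)" "odd (?d c j v)" using odd[of i l] odd[of j l] ij that by blast+
        then have "even (?d c i v + ?d c j v)" unfolding even_add by blast
        then show ?thesis using par[of v] odds that(4) by blast
      next
        case True
        then show ?thesis unfolding other[OF that(2,3)] by blast
      qed
      show ?thesis
      proof (cases "k = i \<or> k = j"; cases "l = i \<or> l = j")
        assume "k = i \<or> k = j" "l = i \<or> l = j"
        then show ?thesis using ij' kl(3) by auto
      next
        assume "k = i \<or> k = j" "\<not> (l = i \<or> l = j)"
        then show ?thesis using one[of l k] kl by blast
      next
        assume "\<not> (k = i \<or> k = j)" "l = i \<or> l = j"
        then show ?thesis using one[of k l] kl by blast
      next
        assume "\<not> (k = i \<or> k = j)" "\<not> (l = i \<or> l = j)"
        then have neq: "k \<noteq> i" "k \<noteq> j" "l \<noteq> i" "l \<noteq> j" by blast+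
        show ?thesis using odd[OF kl] unfolding other[OF neq(1,2)] other[OF neq(3,4)] .
      qed
    qed
    moreover have "\<forall>e\<in>E. c' e \<in> C" using c ij by (auto simp: c'_def)
    moreover have "\<forall>e\<in>E. c e \<noteq> i \<and> c e \<noteq> j \<longrightarrow> c' e = c e" "\<forall>e\<in>E. c e = i \<or> c e = j \<longrightarrow> c' e = i \<or> c' e = j"
      by (auto simp: c'_def)
    ultimately show "\<exists>c'. ?I c' \<and> (\<forall>e\<in>E. c e \<noteq> i \<and> c e \<noteq> j \<longrightarrow> c' e = c e) \<and>
      (\<forall>e\<in>E. c e = i \<or> c e = j \<longrightarrow> c' e = i \<or> c' e = j) \<and>
      (\<forall>x\<in>V. \<bar>int (?d c' i x) - int (?d c' j x)\<bar> \<le> min 2 \<bar>int (?d c i x) - int (?d c j x)\<bar>)"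
      using bound by (intro exI[of _ c'] conjI) blast+
  qed
  then obtain c where c: "?I c" "\<forall>v\<in>V. \<forall>i\<in>C. \<forall>j\<in>C. \<bar>int (?d c i v) - int (?d c j v)\<bar> \<le> 2 \<or> i = j" by blast
  have "?d c i v \<le> ?d c j v + 2" if "v \<in> V" "i \<in> C" "j \<in> C" for v i j
  proof (cases "i = j")
    case False
    then have "\<bar>int (?d c i v) - int (?d c j v)\<bar> \<le> 2" using c(2)[rule_format, OF that] by blast
    then show ?thesis by linarith
  qed simp
  then show ?thesis using c(1) unfolding deg_def by blast
qed

section \<open>Splitting into classes of minimum degree two\<close>

text \<open>In a balanced orientation every vertex has at least \<open>card C\<close> outgoing and as many incoming
  edges, so an equitable colouring of the bipartite graph of tails and heads uses every colour on both
  sides.\<close>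

lemma min_degree_two_classes:
  fixes en :: "'e \<Rightarrow> bool \<Rightarrow> 'v" and C :: "'c set"
  assumes fin: "finite E" "finite C" and "C \<noteq> {}"
    and deg: "\<forall>v\<in>V. 2 * card C \<le> deg E en v"
  shows "\<exists>c. (\<forall>e\<in>E. c e \<in> C) \<and> (\<forall>v\<in>V. \<forall>i\<in>C. 2 \<le> deg {e\<in>E. c e = i} en v)"
proof -
  obtain w :: "'e \<Rightarrow> int" where w: "\<And>e. w e = 1 \<or> w e = -1"
    "\<And>v. \<bar>\<Sum>e\<in>E. w e * (of_bool (en e True = v) - of_bool (en e False = v))\<bar> \<le> 1"
    using balanced_orientation[OF fin(1), of en] by blast
  define src tgt where "src = (\<lambda>e. en e (w e = 1))" and "tgt = (\<lambda>e. en e (w e \<noteq> 1))"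
  have dsplit: "deg F en v = card {e\<in>F. src e = v} + card {e\<in>F. tgt e = v}" if "finite F" for F v
  proof -
    have "ends_at en e v = of_bool (src e = v) + of_bool (tgt e = v)" for e
      using w(1)[of e] by (auto simp: ends_at_def src_def tgt_def)
    then show ?thesis using that by (simp add: deg_def sum.distrib of_bool_def flip: sum.inter_filter)
  qed
  have diff: "\<bar>int (card {e\<in>E. src e = v}) - int (card {e\<in>E. tgt e = v})\<bar> \<le> 1" for v
  proof -
    have "w e * (of_bool (en e True = v) - of_bool (en e False = v)) = of_bool (src e = v) - of_bool (tgt e = v)" for e
      using w(1)[of e] by (auto simp: src_def tgt_def)
    then have "(\<Sum>e\<in>E. w e * (of_bool (en e True = v) - of_bool (en e False = v))) = int (card {e\<in>E. src e = v}) - int (card {e\<in>E. tgt e = v})"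
      using fin(1) by (simp add: sum_subtractf of_bool_def flip: sum.inter_filter)
    then show ?thesis using w(2)[of v] by simp
  qed
  obtain c where c: "\<forall>e\<in>E. c e \<in> C"
    "\<And>x i j. i \<in> C \<Longrightarrow> j \<in> C \<Longrightarrow> card {e\<in>E. c e = i \<and> src e = x} \<le> card {e\<in>E. c e = j \<and> src e = x} + 1"
    "\<And>x i j. i \<in> C \<Longrightarrow> j \<in> C \<Longrightarrow> card {e\<in>E. c e = i \<and> tgt e = x} \<le> card {e\<in>E. c e = j \<and> tgt e = x} + 1"
    using equitable_bipartite_coloring[OF fin assms(3), of src tgt] by blast
  have pos: "0 < card {e\<in>E. c e = i \<and> f e = v}"
    if "card C \<le> card {e\<in>E. f e = v}" "i \<in> C"
      "\<And>j. j \<in> C \<Longrightarrow> card {e\<in>E. c e = j \<and> f e = v} \<le> card {e\<in>E. c e = i \<and> f e = v} + 1" for f i and v :: 'v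
  proof (rule ccontr)
    assume "\<not> ?thesis"
    then have zero: "card {e\<in>E. c e = i \<and> f e = v} = 0" by simp
    have "{e\<in>E. f e = v} = (\<Union>j\<in>C. {e\<in>E. c e = j \<and> f e = v})" using c(1) by auto
    then have "card {e\<in>E. f e = v} \<le> (\<Sum>j\<in>C. card {e\<in>E. c e = j \<and> f e = v})" using card_UN_le[OF fin(2)] by (simp only:)
    also have "\<dots> = (\<Sum>j\<in>C - {i}. card {e\<in>E. c e = j \<and> f e = v})" using that(2) fin(2) zero by (simp add: sum.remove[of C i])
    also have "\<dots> \<le> (\<Sum>j\<in>C - {i}. 1)" using that(3) zero by (intro sum_mono) fastforce
    also have "\<dots> < card C" using card_Diff1_less[OF fin(2) that(2)] by simp
    finally show False using that(1) by simp
  qed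
  have "2 \<le> deg {e\<in>E. c e = i} en v" if "v \<in> V" "i \<in> C" for v i
  proof -
    have "2 * card C \<le> card {e\<in>E. src e = v} + card {e\<in>E. tgt e = v}"
      using deg that(1) dsplit[OF fin(1)] by fastforce
    then have many: "card C \<le> card {e\<in>E. src e = v}" "card C \<le> card {e\<in>E. tgt e = v}" using diff[of v] by linarith+
    have "0 < card {e\<in>E. c e = i \<and> src e = v}" "0 < card {e\<in>E. c e = i \<and> tgt e = v}"
      by (rule pos[OF many(1) that(2) c(2)[OF _ that(2)]], assumption) (rule pos[OF many(2) that(2) c(3)[OF _ that(2)]])
    moreover have "deg {e\<in>E. c e = i} en v = card {e\<in>E. c e = i \<and> src e = v} + card {e\<in>E. c e = i \<and> tgt e = v}"
      using dsplit[of "{e\<in>E. c e = i}" v] fin(1) by simp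
    ultimately show ?thesis by linarith
  qed
  then show ?thesis using c(1) by blast
qed

section \<open>Connectivity and joins\<close>

definition conn :: "('e \<Rightarrow> bool \<Rightarrow> 'v) \<Rightarrow> 'e set \<Rightarrow> ('v \<times> 'v) set" where
  "conn en F = {(en e h, en e (\<not> h)) | e h. e \<in> F}\<^sup>*"

lemma conn_refl [simp]: "(x, x) \<in> conn en F"
  by (simp add: conn_def)

lemma conn_trans: "(x, y) \<in> conn en F \<Longrightarrow> (y, z) \<in> conn en F \<Longrightarrow> (x, z) \<in> conn en F"
  unfolding conn_def by (rule rtrancl_trans)

lemma conn_sym: "(x, y) \<in> conn en F \<Longrightarrow> (y, x) \<in> conn en F"
proof -
  have "sym {(en e h, en e (\<not> h)) | e h. e \<in> F}"
    by (rule symI) (force simp: )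
  then show "(x, y) \<in> conn en F \<Longrightarrow> (y, x) \<in> conn en F"
    unfolding conn_def by (meson sym_rtrancl symD)
qed

lemma conn_mono: "F \<subseteq> G \<Longrightarrow> (x, y) \<in> conn en F \<Longrightarrow> (x, y) \<in> conn en G"
  unfolding conn_def by (erule rtrancl_mono[THEN subsetD, rotated]) blast

lemma conn_edge: "e \<in> F \<Longrightarrow> (en e h, en e (\<not> h)) \<in> conn en F"
  unfolding conn_def by (rule r_into_rtrancl) blast

lemma conn_induct [consumes 1, case_names refl step]:
  assumes "(x, y) \<in> conn en F" and "P x"
    and "\<And>e h. (x, en e h) \<in> conn en F \<Longrightarrow> e \<in> F \<Longrightarrow> P (en e h) \<Longrightarrow> P (en e (\<not> h))"
  shows "P y"
  using assms(1) unfolding conn_def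
proof (induction rule: rtrancl_induct)
  case base
  show ?case by (rule assms(2))
next
  case (step y z)
  then show ?case using assms(3) unfolding conn_def by blast
qed

lemma conn_least:
  assumes "\<forall>e\<in>F. (en e False, en e True) \<in> conn en G" "(x, y) \<in> conn en F"
  shows "(x, y) \<in> conn en G"
  using assms(2)
proof (induction rule: conn_induct)
  case (step e h)
  then have "(en e h, en e (\<not> h)) \<in> conn en G" using assms(1) by (cases h) (auto intro: conn_sym)
  then show ?case using step conn_trans by fast
qed simp

lemma conn_insert:
  assumes "(x, y) \<in> conn en (insert f F)" "(x, y) \<notin> conn en F"
  shows "\<exists>h. (x, en f h) \<in> conn en F \<and> (en f (\<not> h), y) \<in> conn en F"
proof -
  have "(x, y) \<in> conn en F \<or> (\<exists>h. (x, en f h) \<in> conn en F \<and> (en f (\<not> h), y) \<in> conn en F)"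
    using assms(1)
  proof (induction rule: conn_induct)
    case (step e h)
    show ?case
    proof (cases "e = f")
      case False
      then have "(en e h, en e (\<not> h)) \<in> conn en F" using step by (auto intro: conn_edge)
      then show ?thesis using step conn_trans by fast
    next
      case True
      from step(3) show ?thesis
      proof
        assume "(x, en e h) \<in> conn en F"
        then show ?thesis using True by (intro disjI2 exI[of _ h]) simp
      next
        assume "\<exists>h'. (x, en f h') \<in> conn en F \<and> (en f (\<not> h'), en e h) \<in> conn en F"
        then obtain h' where h': "(x, en f h') \<in> conn en F" by blast
        show ?thesis
        proof (cases "h' = h")
          case True
          then show ?thesis using h' \<open>e = f\<close> by (intro disjI2 exI[of _ h]) simp
        next
          case False
          then have "h' = (\<not> h)" by auto
          then show ?thesis using h' \<open>e = f\<close> by simp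
        qed
      qed
    qed
  qed simp
  then show ?thesis using assms(2) by blast
qed

lemma conn_redundant:
  assumes "(en f False, en f True) \<in> conn en F"
  shows "conn en (insert f F) = conn en F"
proof -
  have ends: "\<forall>e\<in>insert f F. (en e False, en e True) \<in> conn en F"
    using assms conn_edge[of _ F en False] by auto
  show ?thesis
  proof (intro equalityI subrelI)
    show "(x, y) \<in> conn en F" if "(x, y) \<in> conn en (insert f F)" for x y
      by (rule conn_least[OF ends that])
    show "(x, y) \<in> conn en (insert f F)" if "(x, y) \<in> conn en F" for x y
      by (rule conn_mono[OF _ that]) blast
  qed
qed

text \<open>An edge set all of whose edges are bridges is a forest.\<close>

lemma bridges_card_less:
  assumes "finite V" "V \<noteq> {}" "finite F" "\<forall>e\<in>F. \<forall>h. en e h \<in> V"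
    and "\<forall>e\<in>F. (en e False, en e True) \<notin> conn en (F - {e})"
  shows "card F < card V"
  using assms
proof (induction "card F" arbitrary: F V rule: less_induct)
  case less
  show ?case
  proof (cases "F = {}")
    case True
    then show ?thesis using less.prems by (simp add: card_gt_0_iff)
  next
    case False
    then obtain f where f: "f \<in> F" by blast
    define A where "A = {v\<in>V. (en f False, v) \<in> conn en (F - {f})}"
    define FA FB where "FA = {e\<in>F - {f}. en e False \<in> A}" and "FB = {e\<in>F - {f}. en e False \<notin> A}"
    have iff: "en e True \<in> A \<longleftrightarrow> en e False \<in> A" if "e \<in> F - {f}" for e
    proof -
      have "(en e False, en e True) \<in> conn en (F - {f})" using conn_edge[OF that, of en False] by simp
      then show ?thesis using that less.prems(4) unfolding A_def by (auto intro: conn_trans conn_sym)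
    qed
    have lt: "card FA < card F" "card FB < card F"
      using less.prems(3) f by (auto simp: FA_def FB_def intro!: psubset_card_mono)
    have "en f False \<in> A" "en f True \<in> V - A" using less.prems(4,5) f by (auto simp: A_def)
    moreover have ends: "\<forall>e\<in>FA. \<forall>h. en e h \<in> A" "\<forall>e\<in>FB. \<forall>h. en e h \<in> V - A"
    proof -
      show "\<forall>e\<in>FA. \<forall>h. en e h \<in> A"
      proof (intro ballI allI)
        fix e h assume "e \<in> FA" then show "en e h \<in> A" using iff[of e] by (cases h) (auto simp: FA_def)
      qed
      show "\<forall>e\<in>FB. \<forall>h. en e h \<in> V - A"
      proof (intro ballI allI)
        fix e h assume "e \<in> FB" then show "en e h \<in> V - A" using iff[of e] less.prems(4) by (cases h) (auto simp: FB_def)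
      qed
    qed
    moreover have "\<forall>e\<in>FA. (en e False, en e True) \<notin> conn en (FA - {e})" "\<forall>e\<in>FB. (en e False, en e True) \<notin> conn en (FB - {e})"
    proof -
      have "(en e False, en e True) \<notin> conn en (G - {e})" if "G \<subseteq> F" "e \<in> G" for G e
      proof
        assume "(en e False, en e True) \<in> conn en (G - {e})"
        then have "(en e False, en e True) \<in> conn en (F - {e})" by (rule conn_mono[rotated]) (use that in blast)
        then show False using less.prems(5) that by auto
      qed
      moreover have "FA \<subseteq> F" "FB \<subseteq> F" by (auto simp: FA_def FB_def)
      ultimately show "\<forall>e\<in>FA. (en e False, en e True) \<notin> conn en (FA - {e})" "\<forall>e\<in>FB. (en e False, en e True) \<notin> conn en (FB - {e})" by blast+
    qed
    moreover have "finite FA" "finite FB" "finite A" "finite (V - A)" using less.prems by (auto simp: FA_def FB_def A_def)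
    ultimately have "card FA < card A" "card FB < card (V - A)"
      using less.hyps[OF lt(1), of A] less.hyps[OF lt(2), of "V - A"] by blast+
    moreover have "card F = Suc (card FA + card FB)"
    proof -
      have "F = insert f (FA \<union> FB)" "FA \<inter> FB = {}" "f \<notin> FA \<union> FB" using f by (auto simp: FA_def FB_def)
      then show ?thesis using \<open>finite FA\<close> \<open>finite FB\<close> by (simp add: card_Un_disjoint)
    qed
    moreover have "card V = card A + card (V - A)"
      using card_Diff_subset[of A V] card_mono[OF less.prems(1), of A] \<open>finite A\<close> by (auto simp: A_def)
    ultimately show ?thesis by linarith
  qed
qed

lemma deg_symmetric_difference:
  assumes "finite J" "finite K"
  shows "odd (deg ((J - K) \<union> (K - J)) en v) \<longleftrightarrow> odd (deg J en v) \<noteq> odd (deg K en v)"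
proof -
  have "deg J en v = deg (J - K) en v + deg (J \<inter> K) en v" "deg K en v = deg (K - J) en v + deg (J \<inter> K) en v"
    unfolding deg_def using assms
    by (subst sum.union_disjoint[symmetric]; (auto intro!: sum.cong)[1])+
  moreover have "deg ((J - K) \<union> (K - J)) en v = deg (J - K) en v + deg (K - J) en v"
    unfolding deg_def using assms by (subst sum.union_disjoint) auto
  ultimately show ?thesis by auto
qed

lemma pair_join:
  assumes "finite D" "(x, y) \<in> conn en D"
  shows "\<exists>J\<subseteq>D. \<forall>v. odd (deg J en v) \<longleftrightarrow> (v = x) \<noteq> (v = y)"
  using assms(2)
proof (induction rule: conn_induct)
  case refl
  show ?case by (intro exI[of _ "{}"]) (simp add: deg_def)
next
  case (step e h)
  then obtain J where J: "J \<subseteq> D" "\<And>v. odd (deg J en v) \<longleftrightarrow> (v = x) \<noteq> (v = en e h)" by blast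
  have "odd (deg {e} en v) \<longleftrightarrow> (v = en e h) \<noteq> (v = en e (\<not> h))" for v
    by (cases h) (auto simp: deg_def ends_at_def)
  then have "odd (deg ((J - {e}) \<union> ({e} - J)) en v) \<longleftrightarrow> (v = x) \<noteq> (v = en e (\<not> h))" for v
    using J(2)[of v] deg_symmetric_difference[of J "{e}" en v] finite_subset[OF J(1) assms(1)] by auto
  then show ?case using J(1) step(2) by (intro exI[of _ "(J - {e}) \<union> ({e} - J)"]) auto
qed

text \<open>Pair up the elements of \<open>T\<close> and add, modulo 2, paths that connect the pairs.\<close>

lemma T_join:
  assumes "finite D" "finite T" "even (card T)" "\<forall>x\<in>T. \<forall>y\<in>T. (x, y) \<in> conn en D"
  shows "\<exists>J\<subseteq>D. \<forall>v. odd (deg J en v) \<longleftrightarrow> v \<in> T"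
  using assms(2-)
proof (induction "card T" arbitrary: T rule: less_induct)
  case less
  show ?case
  proof (cases "T = {}")
    case True
    then show ?thesis by (intro exI[of _ "{}"]) (simp add: deg_def)
  next
    case False
    then obtain x where x: "x \<in> T" by blast
    have "T \<noteq> {x}" using less.prems(2) by auto
    then obtain y where y: "y \<in> T" "y \<noteq> x" using x by blast
    have sub: "{x, y} \<subseteq> T" and two: "card {x, y} = 2" using x y by auto
    have card: "card T = Suc (Suc (card (T - {x, y})))"
      using card_mono[OF less.prems(1) sub] card_Diff_subset[OF _ sub] two by simp
    have "\<exists>J\<subseteq>D. \<forall>v. odd (deg J en v) \<longleftrightarrow> v \<in> T - {x, y}"
      by (rule less.hyps) (use card less.prems in auto)
    then obtain J where J: "J \<subseteq> D" "\<And>v. odd (deg J en v) \<longleftrightarrow> v \<in> T - {x, y}" by blast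
    obtain K where K: "K \<subseteq> D" "\<And>v. odd (deg K en v) \<longleftrightarrow> (v = x) \<noteq> (v = y)"
      using pair_join[OF assms(1), of x y en] x y less.prems(3) by blast
    have "odd (deg ((J - K) \<union> (K - J)) en v) \<longleftrightarrow> v \<in> T" for v
      using J(2)[of v] K(2)[of v] deg_symmetric_difference[of J K en v] finite_subset[OF J(1) assms(1)]
        finite_subset[OF K(1) assms(1)] x y by auto
    then show ?thesis using J(1) K(1) by (intro exI[of _ "(J - K) \<union> (K - J)"]) auto
  qed
qed

section \<open>A vertex set connected by many disjoint edge sets\<close>

text \<open>This is the exchange argument behind the tree packing theorem of Nash-Williams and Tutte. Choose
  a colouring with \<open>m\<close> colours that maximises the number of pairs connected in each colour, summed over the
  colours. An edge that is redundant in its class, that is, not a bridge there, may change to any other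
  colour, and by maximality its ends are already connected in that colour. Let \<open>E0\<close> consist of
  the edges that become redundant after some sequence of such changes. The ends of an edge of \<open>E0\<close>
  are connected by edges of \<open>E0\<close> in every colour, so the components of \<open>E0\<close> are connected in every colour,
  and \<open>E0\<close> is nonempty because \<open>m\<close> forests have at most \<open>m * (card V - 1)\<close> edges.\<close>

lemma dense_connected_subset:
  fixes en :: "'e \<Rightarrow> bool \<Rightarrow> 'v"
  assumes fin: "finite V" "V \<noteq> {}" "finite E" and ends: "\<And>e h. e \<in> E \<Longrightarrow> en e h \<in> V"
    and loopless: "\<And>e. e \<in> E \<Longrightarrow> en e False \<noteq> en e True"
    and m: "m > 0" "m * (card V - 1) < card E"
  shows "\<exists>U c. U \<subseteq> V \<and> 2 \<le> card U \<and>
    (\<forall>i<m. \<forall>x\<in>U. \<forall>y\<in>U. (x, y) \<in> conn en {e\<in>E. c e = i \<and> en e False \<in> U \<and> en e True \<in> U})"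
proof -
  define F where "F = (\<lambda>c (i::nat). {e\<in>E. c e = i})"
  define valid where "valid = (\<lambda>c. \<forall>e\<in>E. c e < m)"
  define \<Phi> where "\<Phi> = (\<lambda>c. \<Sum>i<m. card (conn en (F c i) \<inter> V \<times> V))"
  define optimal where "optimal = (\<lambda>c. valid c \<and> (\<forall>c'. valid c' \<longrightarrow> \<Phi> c' \<le> \<Phi> c))"
  define red where "red = (\<lambda>c e. e \<in> E \<and> (en e False, en e True) \<in> conn en (F c (c e) - {e}))"
  define R where "R = {(c, c'). \<exists>e i. red c e \<and> i < m \<and> c' = c(e := i)}"
  have bounded: "\<Phi> c \<le> m * card (V \<times> V)" for c
  proof -
    have "\<Phi> c \<le> (\<Sum>i<m. card (V \<times> V))" unfolding \<Phi>_def using fin(1) by (intro sum_mono card_mono) auto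
    then show ?thesis by simp
  qed
  have "valid (\<lambda>_. 0)" using m(1) by (simp add: valid_def)
  then have "\<exists>c. optimal c" unfolding optimal_def
    by (rule Lattices_Big.ex_has_greatest_nat[where P = valid and f = \<Phi> and b = "Suc (m * card (V \<times> V))"]) (use bounded le_imp_less_Suc in blast)
  then obtain c0 where c0: "optimal c0" ..
  have recolor: "(en e False, en e True) \<in> conn en (F c i - {e}) \<and> optimal (c(e := i))"
    if c: "optimal c" "red c e" "i < m" for c e i
  proof (cases "i = c e")
    case True
    then have "c(e := i) = c" by simp
    then show ?thesis using c True unfolding red_def by simp
  next
    case False
    let ?c' = "c(e := i)"
    have valid': "valid ?c'" using c by (auto simp: optimal_def valid_def)
    have e: "e \<in> E" using c(2) by (simp add: red_def)
    have mono: "conn en (F c l) \<subseteq> conn en (F ?c' l)" for l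
    proof (cases "l = c e")
      case True
      then have "F ?c' l = F c (c e) - {e}" "F c l = insert e (F c (c e) - {e})" using False e by (auto simp: F_def)
      then show ?thesis using c(2) conn_redundant[of en e "F c (c e) - {e}"] by (simp add: red_def)
    next
      case False
      then have "F c l \<subseteq> F ?c' l" by (auto simp: F_def)
      then show ?thesis by (intro subrelI) (rule conn_mono)
    qed
    have le: "card (conn en (F c l) \<inter> V \<times> V) \<le> card (conn en (F ?c' l) \<inter> V \<times> V)" for l
      using mono[of l] fin(1) by (intro card_mono) auto
    then have "\<Phi> c \<le> \<Phi> ?c'" unfolding \<Phi>_def by (intro sum_mono)
    moreover have \<Phi>: "\<Phi> ?c' \<le> \<Phi> c" using c(1) valid' by (simp add: optimal_def)
    ultimately have opt: "optimal ?c'" using c(1) valid' by (auto simp: optimal_def)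
    have "card (conn en (F c i) \<inter> V \<times> V) = card (conn en (F ?c' i) \<inter> V \<times> V)"
    proof (rule ccontr)
      assume "\<not> ?thesis"
      then have "card (conn en (F c i) \<inter> V \<times> V) < card (conn en (F ?c' i) \<inter> V \<times> V)" using le[of i] by simp
      then have "\<Phi> c < \<Phi> ?c'" unfolding \<Phi>_def using le c(3) by (intro sum_strict_mono_ex1) auto
      then show False using \<Phi> by simp
    qed
    then have "conn en (F c i) \<inter> V \<times> V = conn en (F ?c' i) \<inter> V \<times> V"
      using mono[of i] fin(1) by (intro card_subset_eq) auto
    moreover have "(en e False, en e True) \<in> conn en (F ?c' i) \<inter> V \<times> V"
      using conn_edge[of e "F ?c' i" en False] e ends by (simp add: F_def)
    ultimately have "(en e False, en e True) \<in> conn en (F c i)" by blast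
    moreover have "F c i - {e} = F c i" using False by (auto simp: F_def)
    ultimately show ?thesis using opt by simp
  qed
  have opt: "optimal c" if "(c0, c) \<in> R\<^sup>*" for c
    using that
  proof (induction rule: rtrancl_induct)
    case (step c c')
    then show ?case using recolor unfolding R_def by blast
  qed (rule c0)
  define E0 where "E0 = {e. \<exists>c. (c0, c) \<in> R\<^sup>* \<and> red c e}"
  have E0: "E0 \<subseteq> E" by (auto simp: E0_def red_def)
  \<comment> \<open>On a path of colour \<open>i\<close> with the fewest edges between the ends of \<open>e\<close>, every edge becomes redundant when \<open>e\<close>
    gets colour \<open>i\<close>, as it then lies on a cycle of that colour.\<close>
  have inside: "(en e False, en e True) \<in> conn en ((F c i - {e}) \<inter> E0)"
    if c: "(c0, c) \<in> R\<^sup>*" "red c e" "i < m" for c e i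
  proof -
    have "(en e False, en e True) \<in> conn en (F c i - {e})" using recolor[OF opt[OF c(1)] c(2,3)] by blast
    then obtain P where P: "P \<subseteq> F c i - {e}" "(en e False, en e True) \<in> conn en P"
      and least: "\<And>Q. Q \<subseteq> F c i - {e} \<Longrightarrow> (en e False, en e True) \<in> conn en Q \<Longrightarrow> card P \<le> card Q"
      using ex_has_least_nat[of "\<lambda>P. P \<subseteq> F c i - {e} \<and> (en e False, en e True) \<in> conn en P" "F c i - {e}" card] by blast
    have "P \<subseteq> E" using P(1) by (auto simp: F_def)
    then have finP: "finite P" using fin(3) by (rule finite_subset)
    let ?c' = "c(e := i)"
    have c': "(c0, ?c') \<in> R\<^sup>*" using c by (intro rtrancl_into_rtrancl[OF c(1)]) (auto simp: R_def)
    have "f \<in> E0" if f: "f \<in> P" for f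
    proof -
      have "(en e False, en e True) \<notin> conn en (P - {f})"
        using least[of "P - {f}"] P(1) card_Diff1_less[OF finP f] by auto
      moreover have "insert f (P - {f}) = P" using f by auto
      ultimately obtain h where h: "(en e False, en f h) \<in> conn en (P - {f})" "(en f (\<not> h), en e True) \<in> conn en (P - {f})"
        using conn_insert[of "en e False" "en e True" en f "P - {f}"] P(2) by auto
      have sub: "insert e (P - {f}) \<subseteq> F ?c' i - {f}" using P(1) f c(2) by (auto simp: F_def red_def)
      have sub': "P - {f} \<subseteq> F ?c' i - {f}" using sub by blast
      have before: "(en f h, en e False) \<in> conn en (F ?c' i - {f})"
        and after: "(en e True, en f (\<not> h)) \<in> conn en (F ?c' i - {f})"
        by (rule conn_sym[OF conn_mono[OF sub' h(1)]]) (rule conn_sym[OF conn_mono[OF sub' h(2)]])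
      have "(en e False, en e True) \<in> conn en (F ?c' i - {f})"
        using conn_edge[of e "F ?c' i - {f}" en False] sub by auto
      from conn_trans[OF conn_trans[OF before this] after]
      have "(en f h, en f (\<not> h)) \<in> conn en (F ?c' i - {f})" .
      then have "(en f False, en f True) \<in> conn en (F ?c' i - {f})" by (cases h) (auto intro: conn_sym)
      moreover have "?c' f = i" "f \<in> E" using f P(1) by (auto simp: F_def)
      ultimately show ?thesis using c' by (auto simp: E0_def red_def)
    qed
    then have "P \<subseteq> (F c i - {e}) \<inter> E0" using P(1) by blast
    then show ?thesis using P(2) conn_mono by fast
  qed
  \<comment> \<open>A change of colour removes an edge whose ends stay connected inside \<open>E0\<close>, or adds one whose ends are already connected.\<close>
  have inv: "conn en (F c i \<inter> E0) = conn en (F c0 i \<inter> E0)" if "(c0, c) \<in> R\<^sup>*" "i < m" for c i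
    using that(1)
  proof (induction rule: rtrancl_induct)
    case (step c c')
    then obtain e l where e: "red c e" "l < m" "c' = c(e := l)" unfolding R_def by blast
    let ?X = "(F c i - {e}) \<inter> E0"
    have X: "(en e False, en e True) \<in> conn en ?X" using inside[OF step(1) e(1) that(2)] .
    have "F c i \<inter> E0 = ?X \<or> F c i \<inter> E0 = insert e ?X" "F c' i \<inter> E0 = ?X \<or> F c' i \<inter> E0 = insert e ?X"
      unfolding e(3) F_def by auto
    then have "conn en (F c i \<inter> E0) = conn en ?X" "conn en (F c' i \<inter> E0) = conn en ?X"
      using conn_redundant[OF X] by auto
    then show ?case using step.IH by simp
  qed simp
  have E0conn: "(en e False, en e True) \<in> conn en (F c0 i \<inter> E0)" if "e \<in> E0" "i < m" for e i
  proof -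
    have "\<exists>c. (c0, c) \<in> R\<^sup>* \<and> red c e" using that(1) by (simp only: E0_def mem_Collect_eq)
    then obtain c where c: "(c0, c) \<in> R\<^sup>*" "red c e" by (elim exE conjE)
    have "(en e False, en e True) \<in> conn en (F c i \<inter> E0)"
      using inside[OF c that(2)] by (rule conn_mono[rotated]) blast
    then show ?thesis using inv[OF c(1) that(2)] by simp
  qed
  have "E0 \<noteq> {}"
  proof
    assume "E0 = {}"
    then have nored: "\<not> red c0 e" for e by (auto simp: E0_def)
    have valid0: "valid c0" using c0 by (simp add: optimal_def)
    have "card (F c0 i) \<le> card V - 1" for i
    proof -
      have "card (F c0 i) < card V"
      proof (rule bridges_card_less[OF fin(1,2), of _ en])
        show "finite (F c0 i)" "\<forall>e\<in>F c0 i. \<forall>h. en e h \<in> V" using fin(3) ends by (auto simp: F_def)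
        show "\<forall>e\<in>F c0 i. (en e False, en e True) \<notin> conn en (F c0 i - {e})" using nored by (auto simp: red_def F_def)
      qed
      then show ?thesis by simp
    qed
    then have "(\<Sum>i<m. card (F c0 i)) \<le> (\<Sum>i<m. card V - 1)" by (intro sum_mono)
    moreover have "card E \<le> (\<Sum>i<m. card (F c0 i))"
    proof -
      have "E = (\<Union>i<m. F c0 i)" using valid0 by (auto simp: F_def valid_def)
      then show ?thesis using card_UN_le[of "{..<m}" "F c0"] by simp
    qed
    ultimately show False using m(2) by simp
  qed
  then obtain e0 where e0: "e0 \<in> E0" by blast
  define U where "U = {v\<in>V. (en e0 False, v) \<in> conn en E0}"
  have "{en e0 False, en e0 True} \<subseteq> U"
    using e0 E0 ends conn_edge[of e0 E0 en False] by (auto simp: U_def)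
  moreover have "finite U" using fin(1) by (simp add: U_def)
  moreover have "card {en e0 False, en e0 True} = 2" using loopless e0 E0 by auto
  ultimately have "2 \<le> card U" by (metis card_mono)
  moreover have "(x, y) \<in> conn en {e\<in>E. c0 e = i \<and> en e False \<in> U \<and> en e True \<in> U}"
    if i: "i < m" and xy: "x \<in> U" "y \<in> U" for i x y
  proof -
    have "(x, y) \<in> conn en E0" using xy by (auto simp: U_def intro: conn_trans conn_sym)
    moreover have "\<forall>e\<in>E0. (en e False, en e True) \<in> conn en (F c0 i \<inter> E0)" using E0conn[OF _ i] by (rule ballI)
    ultimately have "(x, y) \<in> conn en (F c0 i \<inter> E0)" by (rule conn_least[rotated])
    then have "y \<in> U \<and> (x, y) \<in> conn en {e\<in>E. c0 e = i \<and> en e False \<in> U \<and> en e True \<in> U}"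
    proof (induction rule: conn_induct)
      case refl
      show ?case using xy by simp
    next
      case (step e h)
      have "(en e h, en e (\<not> h)) \<in> conn en E0" using step(2) by (intro conn_edge) simp
      then have U: "en e (\<not> h) \<in> U" using step E0 ends by (auto simp: U_def intro: conn_trans)
      then have "e \<in> {e\<in>E. c0 e = i \<and> en e False \<in> U \<and> en e True \<in> U}"
        using step by (cases h) (auto simp: F_def)
      from conn_trans[OF conjunct2[OF step(3)] conn_edge[OF this]] U show ?case by (intro conjI)
    qed
    then show ?thesis by blast
  qed
  ultimately show ?thesis unfolding U_def by (intro exI[of _ "{v\<in>V. (en e0 False, v) \<in> conn en E0}"] exI[of _ c0]) (auto simp: U_def)
qed

section \<open>Edge cuts\<close>

definition edge_cut :: "'e set \<Rightarrow> ('e \<Rightarrow> bool \<Rightarrow> 'v) \<Rightarrow> 'v set \<Rightarrow> nat" where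
  "edge_cut E en A = card {e\<in>E. (en e False \<in> A) \<noteq> (en e True \<in> A)}"

lemma edge_cut_sum:
  "finite E \<Longrightarrow> edge_cut E en A = (\<Sum>e\<in>E. of_bool ((en e False \<in> A) \<noteq> (en e True \<in> A)))"
  by (simp add: edge_cut_def of_bool_def flip: sum.inter_filter)

lemma sum_ends_at:
  assumes "finite A"
  shows "(\<Sum>v\<in>A. ends_at en e v) = of_bool (en e False \<in> A) + of_bool (en e True \<in> A)"
  using assms by (simp add: ends_at_def sum.distrib of_bool_def)

lemma sum_deg:
  assumes "finite E" "finite A"
  shows "(\<Sum>v\<in>A. deg E en v) = edge_cut E en A + 2 * card {e\<in>E. en e False \<in> A \<and> en e True \<in> A}"
proof -
  have "(\<Sum>v\<in>A. deg E en v) = (\<Sum>e\<in>E. \<Sum>v\<in>A. ends_at en e v)" unfolding deg_def by (rule sum.swap)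
  also have "\<dots> = (\<Sum>e\<in>E. of_bool ((en e False \<in> A) \<noteq> (en e True \<in> A)) + 2 * of_bool (en e False \<in> A \<and> en e True \<in> A))"
    by (rule sum.cong) (auto simp: sum_ends_at[OF assms(2)])
  also have "\<dots> = edge_cut E en A + 2 * (\<Sum>e\<in>E. of_bool (en e False \<in> A \<and> en e True \<in> A))"
    by (simp add: sum.distrib edge_cut_sum[OF assms(1)] sum_distrib_left)
  also have "(\<Sum>e\<in>E. of_bool (en e False \<in> A \<and> en e True \<in> A)) = card {e\<in>E. en e False \<in> A \<and> en e True \<in> A}"
    using assms(1) by (simp add: of_bool_def flip: sum.inter_filter)
  finally show ?thesis .
qed

lemma even_sum_iff_card_odd:
  fixes f :: "'a \<Rightarrow> nat"
  assumes "finite A"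
  shows "even (\<Sum>a\<in>A. f a) \<longleftrightarrow> even (card {a\<in>A. odd (f a)})"
  using assms
proof (induction A rule: finite_induct)
  case (insert a A)
  have "{b \<in> insert a A. odd (f b)} = (if odd (f a) then insert a {b\<in>A. odd (f b)} else {b\<in>A. odd (f b)})" by auto
  then show ?case using insert by simp
qed simp

lemma edge_cut_parity:
  assumes "finite E" "finite A" and "\<forall>v\<in>A. even (deg E en v + k * of_bool (v \<in> Q))"
  shows "even (edge_cut E en A + k * card (A \<inter> Q))"
proof -
  have "even (\<Sum>v\<in>A. deg E en v + k * of_bool (v \<in> Q))" using assms(3) by (intro dvd_sum) auto
  also have "(\<Sum>v\<in>A. deg E en v + k * of_bool (v \<in> Q)) = (\<Sum>v\<in>A. deg E en v) + k * (\<Sum>v\<in>A. of_bool (v \<in> Q))"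
    by (simp only: sum.distrib sum_distrib_left)
  also have "(\<Sum>v\<in>A. of_bool (v \<in> Q)) = card (A \<inter> Q)"
    using assms(2) by (simp add: of_bool_def Int_def flip: sum.inter_filter)
  finally show ?thesis unfolding sum_deg[OF assms(1,2)] by simp
qed

lemma edge_cut_Int_Un:
  assumes "finite E"
  shows "edge_cut E en (A \<inter> B) + edge_cut E en (A \<union> B) \<le> edge_cut E en A + edge_cut E en B"
  unfolding edge_cut_sum[OF assms] sum.distrib[symmetric] by (rule sum_mono) auto

text \<open>The inequality is strict because of an edge between \<open>A \<inter> B\<close> and the outside of \<open>A \<union> B\<close>.\<close>

lemma edge_cut_Diff_less:
  assumes "finite E" "f \<in> E" "en f (\<not> i) \<in> A \<inter> B" "en f i \<notin> A \<union> B"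
  shows "edge_cut E en (A - B) + edge_cut E en (B - A) < edge_cut E en A + edge_cut E en B"
  unfolding edge_cut_sum[OF assms(1)] sum.distrib[symmetric]
proof (rule sum_strict_mono_ex1[OF assms(1)])
  show "\<exists>e\<in>E. of_bool ((en e False \<in> A - B) \<noteq> (en e True \<in> A - B)) + of_bool ((en e False \<in> B - A) \<noteq> (en e True \<in> B - A))
    < (of_bool ((en e False \<in> A) \<noteq> (en e True \<in> A)) + of_bool ((en e False \<in> B) \<noteq> (en e True \<in> B)) :: nat)"
    using assms(2-) by (intro bexI[of _ f]; cases i) auto
qed auto

lemma edge_cut_complement:
  assumes "\<And>e h. e \<in> E \<Longrightarrow> en e h \<in> V"
  shows "edge_cut E en (V - A) = edge_cut E en A"
  unfolding edge_cut_def using assms by (intro arg_cong[where f = card]) auto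

section \<open>Splitting off at a vertex with even label\<close>

text \<open>\<open>Q\<close> is the set of vertices labelled odd, and a set is odd if it contains an odd number of them. All
  odd cuts have the parity of \<open>l\<close>, so a slide at \<open>b\<close> fails only for a tight odd set, one with a
  cut of size exactly \<open>l\<close>, that contains the far ends of both edges but not \<open>b\<close>. Fix the edge \<open>f\<close>
  from \<open>b\<close> to \<open>x\<close>. Tight odd sets that contain \<open>x\<close> but not \<open>b\<close> are closed under union: either
  intersection and union, or both differences, are odd, and the second case is excluded by the edge \<open>f\<close>.
  If every slide failed, the largest such set would contain all neighbours of \<open>b\<close>, and adding \<open>b\<close> to it
  would give an odd cut smaller than \<open>l\<close>.\<close>

lemma admissible_slide:
  fixes en :: "'e \<Rightarrow> bool \<Rightarrow> 'v"
  assumes fin: "finite V" "finite E" and ends: "\<And>e h. e \<in> E \<Longrightarrow> en e h \<in> V"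
    and Q: "Q \<subseteq> V" "even (card Q)" and parity: "\<forall>v\<in>V. even (deg E en v + k * of_bool (v \<in> Q))"
    and l: "even (l + k)" and cuts: "\<And>A. A \<subseteq> V \<Longrightarrow> odd (card (A \<inter> Q)) \<Longrightarrow> l \<le> edge_cut E en A"
    and b: "b \<in> V" "b \<notin> Q" and f: "f \<in> E" "en f i = b" "en f (\<not> i) \<noteq> b"
  shows "\<exists>g j. g \<in> E \<and> g \<noteq> f \<and> en g j = b \<and>
    (\<forall>A\<subseteq>V. odd (card (A \<inter> Q)) \<longrightarrow> l \<le> edge_cut (E - {f}) (slide en f i g j) A)"
proof (rule ccontr)
  assume neg: "\<not> ?thesis"
  let ?x = "en f (\<not> i)"
  have finQ: "finite Q" using Q fin finite_subset by blast
  have par: "even (edge_cut E en A + l)" if "A \<subseteq> V" "odd (card (A \<inter> Q))" for A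
  proof -
    have "even (edge_cut E en A + k * card (A \<inter> Q))"
      by (rule edge_cut_parity[OF fin(2)]) (use that(1) parity fin finite_subset in auto)
    then show ?thesis using that(2) l by auto
  qed
  define tight where "tight = (\<lambda>B. B \<subseteq> V \<and> odd (card (B \<inter> Q)) \<and> edge_cut E en B = l \<and> ?x \<in> B \<and> b \<notin> B)"
  have blocked: "\<exists>B. tight B \<and> en g (\<not> j) \<in> B" if g: "g \<in> E" "g \<noteq> f" "en g j = b" "en g (\<not> j) \<noteq> b" for g j
  proof -
    let ?en = "slide en f i g j" and ?y = "en g (\<not> j)"
    obtain A where A: "A \<subseteq> V" "odd (card (A \<inter> Q))" "edge_cut (E - {f}) ?en A < l"
      using neg g(1-3) not_le by blast
    have E: "E = insert f (insert g (E - {f, g}))" "E - {f} = insert g (E - {f, g})" using f(1) g(1,2) by auto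
    have rest: "edge_cut (E - {f, g}) ?en A = edge_cut (E - {f, g}) en A"
      unfolding edge_cut_def by (intro arg_cong[where f = card]) (auto simp: slide_def)
    have 1: "edge_cut E en A = of_bool ((b \<in> A) \<noteq> (?x \<in> A)) + of_bool ((b \<in> A) \<noteq> (?y \<in> A)) + edge_cut (E - {f, g}) en A"
    proof -
      have "edge_cut E en A = of_bool ((en f False \<in> A) \<noteq> (en f True \<in> A)) + of_bool ((en g False \<in> A) \<noteq> (en g True \<in> A)) + edge_cut (E - {f, g}) en A"
        unfolding edge_cut_sum[OF fin(2)] edge_cut_sum[OF finite_Diff[OF fin(2)]]
        by (subst E(1)) (use fin(2) g(2) in simp)
      then show ?thesis using f(2) g(3) by (cases i; cases j) auto
    qed
    have 2: "edge_cut (E - {f}) ?en A = of_bool ((?x \<in> A) \<noteq> (?y \<in> A)) + edge_cut (E - {f, g}) en A"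
    proof -
      have "edge_cut (E - {f}) ?en A = of_bool ((?en g False \<in> A) \<noteq> (?en g True \<in> A)) + edge_cut (E - {f, g}) ?en A"
        unfolding edge_cut_sum[OF finite_Diff[OF fin(2)]]
        by (subst E(2)) (use fin(2) g(2) in simp)
      then show ?thesis unfolding rest using g(2) by (cases i; cases j) (auto simp: slide_def)
    qed
    have "l \<le> edge_cut E en A" using cuts A(1,2) by blast
    then have "(?x \<in> A) = (?y \<in> A) \<and> (b \<in> A) \<noteq> (?x \<in> A)"
      using 1 2 A(3) by (cases "b \<in> A"; cases "?x \<in> A"; cases "?y \<in> A"; simp)
    then have sides: "(?x \<in> A) = (?y \<in> A)" "(b \<in> A) \<noteq> (?x \<in> A)" by blast+
    then have "edge_cut E en A < l + 2" using 1 2 A(3) by auto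
    moreover have "edge_cut E en A \<noteq> l + 1" using par[OF A(1,2)] by auto
    ultimately have tightA: "edge_cut E en A = l" using \<open>l \<le> edge_cut E en A\<close> by linarith
    show ?thesis
    proof (cases "?x \<in> A")
      case True
      then show ?thesis using A sides tightA by (intro exI[of _ A]) (auto simp: tight_def)
    next
      case False
      have "card ((V - A) \<inter> Q) + card (A \<inter> Q) = card Q"
      proof -
        have "(V - A) \<inter> Q = Q - A \<inter> Q" using Q(1) by auto
        then show ?thesis using card_Diff_subset[of "A \<inter> Q" Q] card_mono[of Q "A \<inter> Q"] finQ by auto
      qed
      then have "odd (card ((V - A) \<inter> Q))" using A(2) Q(2) by presburger
      moreover have "edge_cut E en (V - A) = l" using edge_cut_complement[of E en V A] ends tightA by simp
      ultimately show ?thesis using False sides ends[OF f(1), of "\<not> i"] ends[OF g(1), of "\<not> j"]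
        by (intro exI[of _ "V - A"]) (auto simp: tight_def)
    qed
  qed
  have union: "tight (A \<union> B)" if "tight A" "tight B" for A B
  proof -
    have fins: "finite A" "finite B" using that fin(1) finite_subset by (auto simp: tight_def)
    have A: "A \<subseteq> V" "odd (card (A \<inter> Q))" "edge_cut E en A = l" "?x \<in> A" "b \<notin> A"
      and B: "B \<subseteq> V" "odd (card (B \<inter> Q))" "edge_cut E en B = l" "?x \<in> B" "b \<notin> B" using that by (auto simp: tight_def)
    have c1: "card (A \<inter> Q) = card ((A - B) \<inter> Q) + card (A \<inter> B \<inter> Q)"
      by (subst card_Un_disjoint[symmetric]) (use fins in \<open>auto intro!: arg_cong[where f = card]\<close>)
    have c2: "card (B \<inter> Q) = card ((B - A) \<inter> Q) + card (A \<inter> B \<inter> Q)"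
      by (subst card_Un_disjoint[symmetric]) (use fins in \<open>auto intro!: arg_cong[where f = card]\<close>)
    have c3: "card ((A \<union> B) \<inter> Q) = card ((A - B) \<inter> Q) + card (B \<inter> Q)"
      by (subst card_Un_disjoint[symmetric]) (use fins in \<open>auto intro!: arg_cong[where f = card]\<close>)
    have odd: "odd (card (A \<inter> B \<inter> Q))"
    proof (rule ccontr)
      assume "\<not> ?thesis"
      then have "odd (card ((A - B) \<inter> Q))" "odd (card ((B - A) \<inter> Q))" using A(2) B(2) c1 c2 by auto
      then have "l \<le> edge_cut E en (A - B)" "l \<le> edge_cut E en (B - A)" using A(1) B(1) by (auto intro!: cuts)
      moreover have "edge_cut E en (A - B) + edge_cut E en (B - A) < edge_cut E en A + edge_cut E en B"
        by (rule edge_cut_Diff_less[OF fin(2) f(1), of en i]) (use A B f(2) in auto)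
      ultimately show False using A(3) B(3) by simp
    qed
    then have "odd (card ((A \<union> B) \<inter> Q))" using c1 c3 A(2) B(2) by auto
    moreover have "l \<le> edge_cut E en (A \<inter> B)" "l \<le> edge_cut E en (A \<union> B)" using odd calculation A(1) B(1) by (auto intro!: cuts)
    then have "edge_cut E en (A \<union> B) = l" using edge_cut_Int_Un[OF fin(2), of en A B] A(3) B(3) by linarith
    ultimately show ?thesis using A B by (auto simp: tight_def)
  qed
  have crossing: "\<exists>j. en g j = b \<and> en g (\<not> j) \<noteq> b" if "(en g False \<in> {b}) \<noteq> (en g True \<in> {b})" for g
    using that by (metis (full_types) singletonD singletonI)
  obtain g where g: "g \<in> E" "g \<noteq> f" "(en g False \<in> {b}) \<noteq> (en g True \<in> {b})"
  proof -
    let ?S = "{e\<in>E. (en e False \<in> {b}) \<noteq> (en e True \<in> {b})}"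
    have "even (edge_cut E en {b} + k * card ({b} \<inter> Q))" by (rule edge_cut_parity[OF fin(2)]) (use parity b in auto)
    then have even: "even (card ?S)" using b(2) by (simp add: edge_cut_def)
    have "f \<in> ?S" using f by (cases i) auto
    moreover have "?S \<noteq> {f}"
    proof
      assume eq: "?S = {f}"
      show False using even unfolding eq by simp
    qed
    ultimately obtain g where "g \<in> ?S" "g \<noteq> f" by blast
    then show ?thesis using that by blast
  qed
  obtain j where "en g j = b" "en g (\<not> j) \<noteq> b" using crossing[OF g(3)] by blast
  then obtain B0 where "tight B0" using blocked[OF g(1,2)] by blast
  moreover have "\<forall>B. tight B \<longrightarrow> card B < Suc (card V)"
    using card_mono[OF fin(1)] by (auto simp: tight_def le_imp_less_Suc)
  ultimately have "\<exists>B. tight B \<and> (\<forall>B'. tight B' \<longrightarrow> card B' \<le> card B)"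
    by (rule Lattices_Big.ex_has_greatest_nat[where P = tight and f = card])
  then obtain B where B: "tight B" "\<And>B'. tight B' \<Longrightarrow> card B' \<le> card B" by blast
  have largest: "B' \<subseteq> B" if "tight B'" for B'
  proof -
    have "finite (B \<union> B')" using B(1) that fin(1) finite_subset by (auto simp: tight_def)
    then have "B = B \<union> B'" using B(2)[OF union[OF B(1) that]] by (intro card_seteq) auto
    then show ?thesis by blast
  qed
  have into: "en e (\<not> h) \<in> B" if "e \<in> E" "en e h = b" "en e (\<not> h) \<noteq> b" for e h
  proof (cases "e = f")
    case True
    then have "h = i" using that f by (cases h; cases i) auto
    then show ?thesis using True B(1) by (simp add: tight_def)
  next
    case False
    then show ?thesis using blocked[OF that(1) False that(2,3)] largest by blast
  qed
  have "{e\<in>E. (en e False \<in> B) \<noteq> (en e True \<in> B)} =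
    {e\<in>E. (en e False \<in> insert b B) \<noteq> (en e True \<in> insert b B)} \<union> {e\<in>E. (en e False \<in> {b}) \<noteq> (en e True \<in> {b})}"
    (is "?L = ?R1 \<union> ?R2")
  proof (intro set_eqI)
    fix e
    have "b \<notin> B" using B(1) by (simp add: tight_def)
    then show "e \<in> ?L \<longleftrightarrow> e \<in> ?R1 \<union> ?R2"
      using into[of e False] into[of e True] by auto
  qed
  moreover have "?R1 \<inter> ?R2 = {}" using into[of _ False] into[of _ True] by auto
  ultimately have "edge_cut E en B = edge_cut E en (insert b B) + edge_cut E en {b}"
    unfolding edge_cut_def using fin(2) by (simp add: card_Un_disjoint)
  moreover have "0 < edge_cut E en {b}"
    unfolding edge_cut_def using f fin(2) by (subst card_gt_0_iff) (cases i; auto)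
  moreover have "l \<le> edge_cut E en (insert b B)"
    by (rule cuts) (use B(1) b in \<open>auto simp: tight_def\<close>)
  ultimately show False using B(1) by (simp add: tight_def)
qed

lemma deg_slide:
  assumes "finite F" "f \<notin> F" "g \<in> F" "en f i = b" "en g j = b"
  shows "deg (insert f F) en v = deg F (slide en f i g j) v + 2 * of_bool (v = b)"
proof -
  have F: "F = insert g (F - {g})" using assms(3) by auto
  have rest: "deg (F - {g}) (slide en f i g j) v = deg (F - {g}) en v"
    unfolding deg_def by (rule sum.cong) (auto simp: slide_def ends_at_def)
  have 1: "deg F en v = ends_at en g v + deg (F - {g}) en v" for en :: "'a \<Rightarrow> bool \<Rightarrow> 'b"
    unfolding deg_def using assms(1,3) by (simp add: sum.remove)
  have "deg (insert f F) en v = ends_at en f v + deg F en v"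
    unfolding deg_def using assms(1,2) by simp
  then show ?thesis unfolding 1[of en] 1[of "slide en f i g j"] rest
    using assms(2-) by (cases i; cases j) (auto simp: slide_def ends_at_def)
qed

section \<open>Colourings with prescribed parities\<close>

lemma deg_Un_disjoint:
  "finite F \<Longrightarrow> finite G \<Longrightarrow> F \<inter> G = {} \<Longrightarrow> deg (F \<union> G) en v = deg F en v + deg G en v"
  unfolding deg_def by (rule sum.union_disjoint)

lemma deg_eq_0: "(\<And>e h. e \<in> F \<Longrightarrow> en e h \<noteq> v) \<Longrightarrow> deg F en v = 0"
  unfolding deg_def ends_at_def by (rule sum.neutral) auto

lemma deg_color_sum:
  fixes k :: nat
  assumes "finite E" "\<forall>e\<in>E. c e < k"
  shows "deg E en v = (\<Sum>i<k. deg {e\<in>E. c e = i} en v)"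
proof -
  have "(\<Sum>i<k. \<Sum>e\<in>{e\<in>E. c e = i}. ends_at en e v) = (\<Sum>e\<in>E. ends_at en e v)"
    by (rule sum.group) (use assms in auto)
  then show ?thesis by (simp add: deg_def)
qed

lemma odd_sum_of_odds: "(\<And>i. i < k \<Longrightarrow> odd (f i) \<longleftrightarrow> q) \<Longrightarrow> even ((\<Sum>i<k. f i) + k * of_bool q)"
  for f :: "nat \<Rightarrow> nat"
  by (induction k) auto

text \<open>Undoing the contraction of \<open>U\<close>. The edges that are not inside \<open>U\<close> have been coloured such that the
  parities are correct outside \<open>U\<close> and on \<open>U\<close> as a whole. Hence for each colour the set
  \<open>T i\<close> of vertices of \<open>U\<close> with a wrong parity has even size, and a join for it exists in the \<open>i\<close>-th connecting
  edge set. All remaining edges inside \<open>U\<close> get the last colour \<open>k - 1\<close>, for which the degrees leave no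
  choice.\<close>

lemma odd_coloring_expand:
  fixes en :: "'e \<Rightarrow> bool \<Rightarrow> 'v"
  assumes fin: "finite V" "finite E" and k: "k > 0" and U: "U \<subseteq> V"
    and parity: "\<forall>v\<in>V. even (deg E en v + k * of_bool (v \<in> Q))"
    and conn: "\<And>i x y. i < k - 1 \<Longrightarrow> x \<in> U \<Longrightarrow> y \<in> U \<Longrightarrow>
      (x, y) \<in> conn en {e\<in>E. c1 e = i \<and> en e False \<in> U \<and> en e True \<in> U}"
    and E2: "E2 = {e\<in>E. \<not> (en e False \<in> U \<and> en e True \<in> U)}"
    and c2: "\<forall>e\<in>E2. c2 e < k"
      "\<And>v i. v \<in> V - U \<Longrightarrow> i < k \<Longrightarrow> odd (deg {e\<in>E2. c2 e = i} en v) \<longleftrightarrow> v \<in> Q"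
      "\<And>i. i < k \<Longrightarrow> odd (\<Sum>v\<in>U. deg {e\<in>E2. c2 e = i} en v) \<longleftrightarrow> odd (card (U \<inter> Q))"
  shows "\<exists>c. (\<forall>e\<in>E. c e < k) \<and> (\<forall>v\<in>V. \<forall>i<k. odd (deg {e\<in>E. c e = i} en v) \<longleftrightarrow> v \<in> Q)"
proof -
  have finU: "finite U" using U fin(1) finite_subset by blast
  define T where "T = (\<lambda>i. {v\<in>U. odd (deg {e\<in>E2. c2 e = i} en v) \<noteq> (v \<in> Q)})"
  define D where "D = (\<lambda>i. {e\<in>E. c1 e = i \<and> en e False \<in> U \<and> en e True \<in> U})"
  have "\<exists>J\<subseteq>D i. \<forall>v. odd (deg J en v) \<longleftrightarrow> v \<in> T i" if i: "i < k - 1" for i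
  proof (rule T_join)
    show "finite (D i)" "finite (T i)" using fin finU by (auto simp: D_def T_def)
    show "\<forall>x\<in>T i. \<forall>y\<in>T i. (x, y) \<in> conn en (D i)" using conn[OF i] by (auto simp: T_def D_def)
    let ?O = "{v\<in>U. odd (deg {e\<in>E2. c2 e = i} en v)}"
    have "odd (card ?O) \<longleftrightarrow> odd (card (U \<inter> Q))"
      using c2(3)[of i] i even_sum_iff_card_odd[OF finU, of "deg {e\<in>E2. c2 e = i} en"] by auto
    moreover have "card ?O + card (U \<inter> Q) = card (T i) + 2 * card (?O \<inter> Q)"
    proof -
      have fins: "finite (?O - Q)" "finite (?O \<inter> Q)" "finite (U \<inter> Q - ?O)" using finU by auto
      have "card ?O = card (?O - Q) + card (?O \<inter> Q)"
        by (subst card_Un_disjoint[symmetric]) (use fins in \<open>auto intro!: arg_cong[where f = card]\<close>)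
      moreover have "card (U \<inter> Q) = card (U \<inter> Q - ?O) + card (?O \<inter> Q)"
        by (subst card_Un_disjoint[symmetric]) (use fins in \<open>auto intro!: arg_cong[where f = card]\<close>)
      moreover have "card (T i) = card (?O - Q) + card (U \<inter> Q - ?O)"
        unfolding T_def by (subst card_Un_disjoint[symmetric]) (use fins in \<open>auto intro!: arg_cong[where f = card]\<close>)
      ultimately show ?thesis by simp
    qed
    ultimately show "even (card (T i))" by presburger
  qed
  then have "\<forall>i. \<exists>J. i < k - 1 \<longrightarrow> J \<subseteq> D i \<and> (\<forall>v. odd (deg J en v) \<longleftrightarrow> v \<in> T i)" by blast
  from choice[OF this] obtain J where J: "\<And>i. i < k - 1 \<Longrightarrow> J i \<subseteq> D i" "\<And>i v. i < k - 1 \<Longrightarrow> odd (deg (J i) en v) \<longleftrightarrow> v \<in> T i"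
    by blast
  define c where "c = (\<lambda>e. if e \<in> E2 then c2 e else if c1 e < k - 1 \<and> e \<in> J (c1 e) then c1 e else k - 1)"
  have ran: "\<forall>e\<in>E. c e < k" using c2(1) k by (auto simp: c_def)
  have small: "odd (deg {e\<in>E. c e = i} en v) \<longleftrightarrow> v \<in> Q" if i: "i < k - 1" and v: "v \<in> V" for i v
  proof -
    have eq: "{e\<in>E. c e = i} = {e\<in>E2. c2 e = i} \<union> J i"
      using J(1)[OF i] i by (auto simp: c_def E2 D_def)
    have dis: "{e\<in>E2. c2 e = i} \<inter> J i = {}" using J(1)[OF i] by (auto simp: E2 D_def)
    have fins: "finite {e\<in>E2. c2 e = i}" "finite (J i)"
      using J(1)[OF i] fin(2) finite_subset[of "J i" E] by (auto simp: E2 D_def)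
    have "i < k" using i by linarith
    then show ?thesis unfolding eq deg_Un_disjoint[OF fins dis] even_add
      using J(2)[OF i, of v] c2(2)[of v i] v by (auto simp: T_def)
  qed
  moreover have "odd (deg {e\<in>E. c e = k - 1} en v) \<longleftrightarrow> v \<in> Q" if v: "v \<in> V" for v
  proof -
    have "{..<k} = insert (k - 1) {..<k - 1}" using k by auto
    then have "deg E en v = deg {e\<in>E. c e = k - 1} en v + (\<Sum>i<k - 1. deg {e\<in>E. c e = i} en v)"
      using deg_color_sum[OF fin(2) ran, of en v] by simp
    moreover have "even ((\<Sum>i<k - 1. deg {e\<in>E. c e = i} en v) + (k - 1) * of_bool (v \<in> Q))"
      by (rule odd_sum_of_odds) (use small[OF _ v] in blast)
    moreover have "even (deg E en v + k * of_bool (v \<in> Q))" using parity v by blast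
    ultimately show ?thesis using k by (cases "v \<in> Q") (auto simp: even_add)
  qed
  ultimately have "odd (deg {e\<in>E. c e = i} en v) \<longleftrightarrow> v \<in> Q" if "v \<in> V" "i < k" for v i
    using that by (cases "i = k - 1") auto
  then show ?thesis using ran by blast
qed

text \<open>The set \<open>U\<close> is shrunk to its element \<open>u\<close>.\<close>

definition contract :: "'v set \<Rightarrow> 'v \<Rightarrow> ('e \<Rightarrow> bool \<Rightarrow> 'v) \<Rightarrow> 'e \<Rightarrow> bool \<Rightarrow> 'v" where
  "contract U u en e h = (if en e h \<in> U then u else en e h)"

lemma deg_contract:
  assumes "finite U" "u \<in> U" "finite F"
  shows "v \<notin> U \<Longrightarrow> deg F (contract U u en) v = deg F en v"
    and "deg F (contract U u en) u = (\<Sum>v\<in>U. deg F en v)"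
proof -
  show "deg F (contract U u en) v = deg F en v" if "v \<notin> U"
    unfolding deg_def by (rule sum.cong) (use that assms(2) in \<open>auto simp: ends_at_def contract_def\<close>)
  have "(\<Sum>v\<in>U. deg F en v) = (\<Sum>e\<in>F. \<Sum>v\<in>U. ends_at en e v)" unfolding deg_def by (rule sum.swap)
  also have "\<dots> = deg F (contract U u en) u"
    unfolding deg_def sum_ends_at[OF assms(1)]
    by (rule sum.cong) (use assms(2) in \<open>auto simp: ends_at_def contract_def\<close>)
  finally show "deg F (contract U u en) u = (\<Sum>v\<in>U. deg F en v)" ..
qed

text \<open>The induction step if all labels are odd. Summing the cuts of single vertices shows that there are more than
  \<open>(k - 1) * (card V - 1)\<close> edges that are not loops, so some set \<open>U\<close> is connected by \<open>k - 1\<close>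
  disjoint edge sets. After the contraction the label of \<open>u\<close> is the parity of \<open>card U\<close>, and the odd
  cuts of the smaller graph are odd cuts of the given one.\<close>

lemma odd_coloring_contract:
  fixes en :: "'e \<Rightarrow> bool \<Rightarrow> 'v"
  assumes fin: "finite V" "finite E" and ends: "\<And>e h. e \<in> E \<Longrightarrow> en e h \<in> V"
    and k: "2 \<le> k" "2 * k - 2 \<le> l" and "V \<noteq> {}"
    and parity: "\<forall>v\<in>V. even (deg E en v + k)"
    and cuts: "\<And>A. A \<subseteq> V \<Longrightarrow> odd (card A) \<Longrightarrow> l \<le> edge_cut E en A"
    and IH: "\<And>(V' :: 'v set) (E' :: 'e set) en' Q'. card V' + card E' < card V + card E \<Longrightarrow> finite V' \<Longrightarrow> finite E' \<Longrightarrow>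
      (\<And>e h. e \<in> E' \<Longrightarrow> en' e h \<in> V') \<Longrightarrow> Q' \<subseteq> V' \<Longrightarrow> \<forall>v\<in>V'. even (deg E' en' v + k * of_bool (v \<in> Q')) \<Longrightarrow>
      (\<And>A. A \<subseteq> V' \<Longrightarrow> odd (card (A \<inter> Q')) \<Longrightarrow> l \<le> edge_cut E' en' A) \<Longrightarrow>
      \<exists>c. (\<forall>e\<in>E'. c e < k) \<and> (\<forall>v\<in>V'. \<forall>i<k. odd (deg {e\<in>E'. c e = i} en' v) \<longleftrightarrow> v \<in> Q')"
  shows "\<exists>c. (\<forall>e\<in>E. c e < k) \<and> (\<forall>v\<in>V. \<forall>i<k. odd (deg {e\<in>E. c e = i} en v))"
proof -
  define N where "N = {e\<in>E. en e False \<noteq> en e True}"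
  have "(\<Sum>v\<in>V. edge_cut E en {v}) = 2 * card N"
  proof -
    have "(\<Sum>v\<in>V. edge_cut E en {v}) = (\<Sum>e\<in>E. \<Sum>v\<in>V. of_bool ((en e False \<in> {v}) \<noteq> (en e True \<in> {v})))"
      unfolding edge_cut_sum[OF fin(2)] by (rule sum.swap)
    also have "\<dots> = (\<Sum>e\<in>E. 2 * of_bool (e \<in> N))"
    proof (rule sum.cong)
      fix e assume e: "e \<in> E"
      show "(\<Sum>v\<in>V. of_bool ((en e False \<in> {v}) \<noteq> (en e True \<in> {v}))) = (2 * of_bool (e \<in> N) :: nat)"
      proof (cases "e \<in> N")
        case True
        then have "(\<Sum>v\<in>V. of_bool ((en e False \<in> {v}) \<noteq> (en e True \<in> {v}))) = (\<Sum>v\<in>V. ends_at en e v)"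
          by (intro sum.cong) (auto simp: ends_at_def N_def)
        then show ?thesis using True ends[OF e] by (simp add: sum_ends_at[OF fin(1)])
      qed (use e in \<open>auto simp: N_def\<close>)
    qed simp
    also have "\<dots> = 2 * card (E \<inter> N)" using fin(2) by (simp add: of_bool_def Int_def flip: sum.inter_filter sum_distrib_left)
    also have "E \<inter> N = N" by (auto simp: N_def)
    finally show ?thesis .
  qed
  moreover have "(\<Sum>v\<in>V. 2 * k - 2) \<le> (\<Sum>v\<in>V. edge_cut E en {v})"
    using k(2) cuts[of "{_}"] by (intro sum_mono) (force intro: order_trans)
  ultimately have "card V * (2 * k - 2) \<le> 2 * card N" by simp
  moreover have "card V * (2 * k - 2) = 2 * (card V * (k - 1))" by (simp add: algebra_simps diff_mult_distrib2)
  ultimately have "card V * (k - 1) \<le> card N" by linarith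
  moreover have "(k - 1) * (card V - 1) < card V * (k - 1)"
    using k(1) \<open>V \<noteq> {}\<close> fin(1) by (simp add: mult.commute card_gt_0_iff)
  ultimately have dense: "(k - 1) * (card V - 1) < card N" by linarith
  have "\<exists>U c. U \<subseteq> V \<and> 2 \<le> card U \<and>
    (\<forall>i<k - 1. \<forall>x\<in>U. \<forall>y\<in>U. (x, y) \<in> conn en {e\<in>N. c e = i \<and> en e False \<in> U \<and> en e True \<in> U})"
  proof (rule dense_connected_subset[OF fin(1) \<open>V \<noteq> {}\<close> _ _ _ _ dense])
    show "finite N" "k - 1 > 0" using fin(2) k(1) by (auto simp: N_def)
    show "en e h \<in> V" if "e \<in> N" for e h using that ends by (simp add: N_def)
    show "en e False \<noteq> en e True" if "e \<in> N" for e using that by (simp add: N_def)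
  qed
  then obtain U c1 where U: "U \<subseteq> V" "2 \<le> card U"
    and c1: "\<forall>i<k - 1. \<forall>x\<in>U. \<forall>y\<in>U. (x, y) \<in> conn en {e\<in>N. c1 e = i \<and> en e False \<in> U \<and> en e True \<in> U}"
    by (elim exE conjE)
  have finU: "finite U" using U(1) fin(1) finite_subset by blast
  obtain u where u: "u \<in> U" using U(2) by fastforce
  define E2 where "E2 = {e\<in>E. \<not> (en e False \<in> U \<and> en e True \<in> U)}"
  define V2 where "V2 = insert u (V - U)"
  define Q2 where "Q2 = V - U \<union> (if odd (card U) then {u} else {})"
  let ?en = "contract U u en"
  have finE2: "finite E2" using fin(2) by (simp add: E2_def)
  have cardV2: "card V2 < card V"
  proof -
    have "card V2 = Suc (card V - card U)" unfolding V2_def using u finU U(1) fin(1) by (simp add: card_Diff_subset)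
    then show ?thesis using U(2) card_mono[OF fin(1) U(1)] by linarith
  qed
  have E: "E = E2 \<union> {e\<in>E. en e False \<in> U \<and> en e True \<in> U}" by (auto simp: E2_def)
  have "\<exists>c. (\<forall>e\<in>E2. c e < k) \<and> (\<forall>v\<in>V2. \<forall>i<k. odd (deg {e\<in>E2. c e = i} ?en v) \<longleftrightarrow> v \<in> Q2)"
  proof (rule IH)
    have "card E2 \<le> card E" using fin(2) by (auto simp: E2_def intro!: card_mono)
    then show "card V2 + card E2 < card V + card E" using cardV2 by linarith
    show "finite V2" "finite E2" using fin(1) finE2 by (auto simp: V2_def)
    show "?en e h \<in> V2" if "e \<in> E2" for e h
      using that ends by (auto simp: E2_def V2_def contract_def)
    show "Q2 \<subseteq> V2" by (auto simp: Q2_def V2_def)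
    have old: "deg E en v = deg E2 en v + deg {e\<in>E. en e False \<in> U \<and> en e True \<in> U} en v" for v
      by (subst E, rule deg_Un_disjoint) (use fin finE2 in \<open>auto simp: E2_def\<close>)
    show "\<forall>v\<in>V2. even (deg E2 ?en v + k * of_bool (v \<in> Q2))"
    proof
      fix v assume "v \<in> V2"
      show "even (deg E2 ?en v + k * of_bool (v \<in> Q2))"
      proof (cases "v \<in> U")
        case False
        then have v: "v \<in> V" "v \<in> Q2" using \<open>v \<in> V2\<close> u by (auto simp: V2_def Q2_def)
        have "deg {e\<in>E. en e False \<in> U \<and> en e True \<in> U} en v = 0"
          by (rule deg_eq_0) (use False in \<open>auto split: bool.splits\<close>, (metis (full_types))?)
        then show ?thesis using parity v old[of v] deg_contract(1)[OF finU u finE2 False] by auto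
      next
        case True
        then have "v = u" using \<open>v \<in> V2\<close> u by (auto simp: V2_def)
        have "u \<in> Q2 \<longleftrightarrow> odd (card U)" using u by (auto simp: Q2_def)
        have "even (\<Sum>v\<in>U. deg E en v + k)" using parity U(1) by (intro dvd_sum) auto
        then have "even ((\<Sum>v\<in>U. deg E en v) + card U * k)" by (simp add: sum.distrib)
        moreover have "(\<Sum>v\<in>U. deg E en v) = (\<Sum>v\<in>U. deg E2 en v) + 2 * card {e\<in>E. en e False \<in> U \<and> en e True \<in> U}"
        proof -
          let ?I = "{e\<in>E. en e False \<in> U \<and> en e True \<in> U}"
          have "(\<Sum>v\<in>U. deg ?I en v) = (\<Sum>e\<in>?I. \<Sum>v\<in>U. ends_at en e v)" unfolding deg_def by (rule sum.swap)
          also have "\<dots> = (\<Sum>e\<in>?I. 2)" by (rule sum.cong) (auto simp: sum_ends_at[OF finU])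
          finally show ?thesis by (simp add: old sum.distrib)
        qed
        ultimately show ?thesis unfolding \<open>v = u\<close> deg_contract(2)[OF finU u finE2] \<open>u \<in> Q2 \<longleftrightarrow> odd (card U)\<close>
          by (cases "odd (card U)") auto
      qed
    qed
    show "l \<le> edge_cut E2 ?en A" if A: "A \<subseteq> V2" "odd (card (A \<inter> Q2))" for A
    proof -
      define B where "B = (if u \<in> A then A \<union> U else A)"
      have B: "B \<subseteq> V" using A(1) U(1) u by (auto simp: B_def V2_def)
      have mem: "contract U u en e h \<in> A \<longleftrightarrow> en e h \<in> B" for e h
        using A(1) u by (auto simp: B_def V2_def contract_def)
      have "{e\<in>E2. (?en e False \<in> A) \<noteq> (?en e True \<in> A)} = {e\<in>E. (en e False \<in> B) \<noteq> (en e True \<in> B)}"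
        unfolding mem E2_def using A(1) u by (auto simp: B_def V2_def)
      then have "edge_cut E2 ?en A = edge_cut E en B" by (simp add: edge_cut_def)
      moreover have "odd (card B)"
      proof (cases "u \<in> A")
        case False
        then have "A \<inter> Q2 = B" using A(1) by (auto simp: B_def V2_def Q2_def)
        then show ?thesis using A(2) by simp
      next
        case True
        define A' where "A' = A - {u}"
        have A': "A' \<subseteq> V - U" "u \<notin> A'" "finite A'" and dis: "A' \<inter> U = {}"
          using A(1) fin(1) finite_subset[of A' "V - U"] by (auto simp: V2_def A'_def)
        have "B = A' \<union> U" using True u by (auto simp: B_def A'_def)
        then have cB: "card B = card A' + card U" using finU A'(3) dis by (simp add: card_Un_disjoint)
        have "A \<inter> Q2 = (if odd (card U) then insert u A' else A')"
          using True A' u by (auto simp: Q2_def A'_def)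
        then have "card (A \<inter> Q2) = card A' + of_bool (odd (card U))"
          using A' by (cases "odd (card U)") (simp_all only: if_True if_False card_insert_disjoint of_bool_eq, simp_all)
        then show ?thesis using cB A(2) by (cases "odd (card U)") auto
      qed
      ultimately show ?thesis using cuts[OF B] by simp
    qed
  qed
  then obtain c2 where c2: "\<forall>e\<in>E2. c2 e < k" "\<And>v i. v \<in> V2 \<Longrightarrow> i < k \<Longrightarrow> odd (deg {e\<in>E2. c2 e = i} ?en v) \<longleftrightarrow> v \<in> Q2" by blast
  have finc: "finite {e\<in>E2. c2 e = i}" for i using finE2 by simp
  have "\<exists>c. (\<forall>e\<in>E. c e < k) \<and> (\<forall>v\<in>V. \<forall>i<k. odd (deg {e\<in>E. c e = i} en v) \<longleftrightarrow> v \<in> V)"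
  proof (rule odd_coloring_expand[OF fin _ U(1) _ _ E2_def c2(1)])
    show "k > 0" using k(1) by simp
    show "\<forall>v\<in>V. even (deg E en v + k * of_bool (v \<in> V))" using parity by simp
    show "(x, y) \<in> conn en {e\<in>E. c1 e = i \<and> en e False \<in> U \<and> en e True \<in> U}" if "i < k - 1" "x \<in> U" "y \<in> U" for i x y
      by (rule conn_mono[OF _ c1[rule_format, OF that]]) (auto simp: N_def)
    show "odd (deg {e\<in>E2. c2 e = i} en v) \<longleftrightarrow> v \<in> V" if "v \<in> V - U" "i < k" for v i
      using c2(2)[of v i] that deg_contract(1)[OF finU u finc, of v i en] by (auto simp: V2_def Q2_def)
    show "odd (\<Sum>v\<in>U. deg {e\<in>E2. c2 e = i} en v) \<longleftrightarrow> odd (card (U \<inter> V))" if "i < k" for i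
    proof -
      have "U \<inter> V = U" using U(1) by auto
      then show ?thesis using c2(2)[of u i] that u unfolding deg_contract(2)[OF finU u finc] by (auto simp: V2_def Q2_def)
    qed
  qed
  then show ?thesis by blast
qed

text \<open>Induction on the number of vertices and edges. A slide at a vertex \<open>b\<close> with even label
  deletes an edge; the two edges it merges get the same colour, which changes no parity.
  A vertex with even label that has only loops can be deleted. If all labels are odd, a vertex set is
  contracted.\<close>

lemma odd_coloring_large_cuts:
  fixes en :: "'e \<Rightarrow> bool \<Rightarrow> 'v"
  assumes k: "2 \<le> k" "2 * k - 2 \<le> l" "even (l + k)"
    and "finite V" "finite E" "\<And>e h. e \<in> E \<Longrightarrow> en e h \<in> V" "Q \<subseteq> V"
    and "\<forall>v\<in>V. even (deg E en v + k * of_bool (v \<in> Q))"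
    and "\<And>A. A \<subseteq> V \<Longrightarrow> odd (card (A \<inter> Q)) \<Longrightarrow> l \<le> edge_cut E en A"
  shows "\<exists>c. (\<forall>e\<in>E. c e < k) \<and> (\<forall>v\<in>V. \<forall>i<k. odd (deg {e\<in>E. c e = i} en v) \<longleftrightarrow> v \<in> Q)"
  using assms(4-)
proof (induction "card V + card E" arbitrary: V E en Q rule: less_induct)
  case less
  note fin = less.prems(1,2) and ends = less.prems(3) and Q = less.prems(4) and parity = less.prems(5) and cuts = less.prems(6)
  consider "V = {}" | "V \<noteq> {}" "Q = V" | b where "b \<in> V" "b \<notin> Q" using Q by blast
  then show ?case
  proof cases
    case 1
    then have "E = {}" using ends by blast
    then show ?thesis using 1 by simp
  next
    case 2
    have "\<exists>c. (\<forall>e\<in>E. c e < k) \<and> (\<forall>v\<in>V. \<forall>i<k. odd (deg {e\<in>E. c e = i} en v))"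
    proof (rule odd_coloring_contract[OF fin _ k(1,2) 2(1)])
      show "en e h \<in> V" if "e \<in> E" for e h using that by (rule ends)
      show "\<forall>v\<in>V. even (deg E en v + k)" using parity 2(2) by simp
      show "l \<le> edge_cut E en A" if "A \<subseteq> V" "odd (card A)" for A
        using cuts[OF that(1)] that 2(2) by (simp add: Int_absorb2)
    qed (rule less.hyps)
    then show ?thesis using 2(2) by simp
  next
    case b: (3 b)
    show ?thesis
    proof (cases "\<exists>f\<in>E. \<exists>i. en f i = b \<and> en f (\<not> i) \<noteq> b")
      case True
      then obtain f i where f: "f \<in> E" "en f i = b" "en f (\<not> i) \<noteq> b" by blast
      have "even (card Q)"
      proof (rule ccontr)
        assume "odd (card Q)"
        then have "l \<le> edge_cut E en V" using cuts[of V] Q by (simp add: Int_absorb1)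
        moreover have none: "{e\<in>E. (en e False \<in> V) \<noteq> (en e True \<in> V)} = {}" using ends by blast
        ultimately have "l \<le> 0" unfolding edge_cut_def none by simp
        then show False using k(1,2) by simp
      qed
      have "\<exists>g j. g \<in> E \<and> g \<noteq> f \<and> en g j = b \<and>
        (\<forall>A\<subseteq>V. odd (card (A \<inter> Q)) \<longrightarrow> l \<le> edge_cut (E - {f}) (slide en f i g j) A)"
      proof (rule admissible_slide[OF fin _ Q \<open>even (card Q)\<close> parity k(3) _ b f])
        show "en e h \<in> V" if "e \<in> E" for e h using that by (rule ends)
        show "l \<le> edge_cut E en A" if "A \<subseteq> V" "odd (card (A \<inter> Q))" for A using that by (rule cuts)
      qed
      then obtain g j where g: "g \<in> E" "g \<noteq> f" "en g j = b"
        and cuts': "\<And>A. A \<subseteq> V \<Longrightarrow> odd (card (A \<inter> Q)) \<Longrightarrow> l \<le> edge_cut (E - {f}) (slide en f i g j) A"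
        by blast
      let ?en = "slide en f i g j"
      have E: "E = insert f (E - {f})" using f(1) by auto
      have deg: "deg E en v = deg (E - {f}) ?en v + 2 * of_bool (v = b)" for v
        by (subst E, rule deg_slide) (use fin f g in auto)
      have "\<exists>c. (\<forall>e\<in>E - {f}. c e < k) \<and> (\<forall>v\<in>V. \<forall>i<k. odd (deg {e\<in>E - {f}. c e = i} ?en v) \<longleftrightarrow> v \<in> Q)"
      proof (rule less.hyps[OF _ fin(1) _ _ Q])
        show "card V + card (E - {f}) < card V + card E" using card_Diff1_less[OF fin(2) f(1)] by simp
        show "finite (E - {f})" using fin(2) by simp
        show "l \<le> edge_cut (E - {f}) ?en A" if "A \<subseteq> V" "odd (card (A \<inter> Q))" for A using that by (rule cuts')
        show "?en e h \<in> V" if "e \<in> E - {f}" for e h using that ends f(1) by (auto simp: slide_def)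
        show "\<forall>v\<in>V. even (deg (E - {f}) ?en v + k * of_bool (v \<in> Q))"
        proof
          fix v assume "v \<in> V"
          then have "even (deg E en v + k * of_bool (v \<in> Q))" using parity by blast
          then show "even (deg (E - {f}) ?en v + k * of_bool (v \<in> Q))" unfolding deg by simp
        qed
      qed
      then obtain c where c: "\<forall>e\<in>E - {f}. c e < k" "\<And>v i. v \<in> V \<Longrightarrow> i < k \<Longrightarrow> odd (deg {e\<in>E - {f}. c e = i} ?en v) \<longleftrightarrow> v \<in> Q" by blast
      let ?c = "c(f := c g)"
      have "odd (deg {e\<in>E. ?c e = m} en v) \<longleftrightarrow> odd (deg {e\<in>E - {f}. c e = m} ?en v)" for m v
      proof (cases "c g = m")
        case True
        then have "{e\<in>E. ?c e = m} = insert f {e\<in>E - {f}. c e = m}" using f(1) by auto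
        moreover have "deg (insert f {e\<in>E - {f}. c e = m}) en v = deg {e\<in>E - {f}. c e = m} ?en v + 2 * of_bool (v = b)"
          by (rule deg_slide) (use fin f g True in auto)
        ultimately show ?thesis by simp
      next
        case False
        then have "{e\<in>E. ?c e = m} = {e\<in>E - {f}. c e = m}" using f(1) by auto
        moreover have "deg {e\<in>E - {f}. c e = m} en v = deg {e\<in>E - {f}. c e = m} ?en v"
          unfolding deg_def by (rule sum.cong) (use False in \<open>auto simp: slide_def ends_at_def\<close>)
        ultimately show ?thesis by simp
      qed
      then show ?thesis using c g by (intro exI[of _ ?c]) auto
    next
      case False
      define E' where "E' = {e\<in>E. en e False \<noteq> b}"
      have other: "en e True = b \<longleftrightarrow> en e False = b" if "e \<in> E" for e
        using False that by (metis (full_types))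
      have ends': "en e h \<in> V - {b}" if "e \<in> E'" for e h
        using that ends other[of e] by (cases h) (auto simp: E'_def)
      have E: "E = E' \<union> {e\<in>E. en e False = b}" by (auto simp: E'_def)
      have fin': "finite E'" "finite {e\<in>E. en e False = b}" "E' \<inter> {e\<in>E. en e False = b} = {}" using fin by (auto simp: E'_def)
      have loops: "deg F en v = 0" if "F \<subseteq> {e\<in>E. en e False = b}" "v \<noteq> b" for F v
      proof (rule deg_eq_0)
        fix e h assume "e \<in> F"
        then have "en e False = b" "en e True = b" using that(1) other by auto
        then show "en e h \<noteq> v" using that(2) by (cases h) auto
      qed
      have deg: "deg E en v = deg E' en v" if "v \<noteq> b" for v
        by (subst E, subst deg_Un_disjoint[OF fin']) (use loops that in simp)
      have "\<exists>c. (\<forall>e\<in>E'. c e < k) \<and> (\<forall>v\<in>V - {b}. \<forall>i<k. odd (deg {e\<in>E'. c e = i} en v) \<longleftrightarrow> v \<in> Q)"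
      proof (rule less.hyps)
        have "card E' \<le> card E" using fin(2) by (auto simp: E'_def intro: card_mono)
        then show "card (V - {b}) + card E' < card V + card E" using card_Diff1_less[OF fin(1) b(1)] by linarith
        show "finite (V - {b})" "finite E'" "Q \<subseteq> V - {b}" using fin fin' Q b by auto
        show "en e h \<in> V - {b}" if "e \<in> E'" for e h by (rule ends'[OF that])
        show "\<forall>v\<in>V - {b}. even (deg E' en v + k * of_bool (v \<in> Q))"
        proof
          fix v assume v: "v \<in> V - {b}"
          then have "even (deg E en v + k * of_bool (v \<in> Q))" using parity by blast
          then show "even (deg E' en v + k * of_bool (v \<in> Q))" using deg[of v] v by simp
        qed
        show "l \<le> edge_cut E' en A" if "A \<subseteq> V - {b}" "odd (card (A \<inter> Q))" for A
        proof -
          have "{e\<in>E'. (en e False \<in> A) \<noteq> (en e True \<in> A)} = {e\<in>E. (en e False \<in> A) \<noteq> (en e True \<in> A)}"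
            using that(1) other by (auto simp: E'_def)
          then show ?thesis using cuts[of A] that by (auto simp: edge_cut_def)
        qed
      qed
      then obtain c where c: "\<forall>e\<in>E'. c e < k" "\<And>v i. v \<in> V - {b} \<Longrightarrow> i < k \<Longrightarrow> odd (deg {e\<in>E'. c e = i} en v) \<longleftrightarrow> v \<in> Q" by blast
      define c' where "c' = (\<lambda>e. if e \<in> E' then c e else 0)"
      have "odd (deg {e\<in>E. c' e = i} en v) \<longleftrightarrow> v \<in> Q" if v: "v \<in> V" and i: "i < k" for v i
      proof (cases "v = b")
        case True
        have "even (ends_at en e b)" if "e \<in> E" for e using other[OF that] by (simp add: ends_at_def)
        then have "even (deg {e\<in>E. c' e = i} en b)" unfolding deg_def by (intro dvd_sum) auto
        then show ?thesis using True b(2) by simp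
      next
        case False
        have "{e\<in>E. c' e = i} = {e\<in>E'. c e = i} \<union> {e\<in>E - E'. 0 = i}" by (auto simp: c'_def E'_def)
        moreover have "deg ({e\<in>E'. c e = i} \<union> {e\<in>E - E'. 0 = i}) en v = deg {e\<in>E'. c e = i} en v + deg {e\<in>E - E'. 0 = i} en v"
          by (rule deg_Un_disjoint) (use fin fin' in auto)
        moreover have "deg {e\<in>E - E'. 0 = i} en v = 0" by (rule loops[OF _ False]) (auto simp: E'_def)
        ultimately show ?thesis using c(2)[of v i] False v i by simp
      qed
      moreover have "\<forall>e\<in>E. c' e < k" using c(1) k(1) by (auto simp: c'_def)
      ultimately show ?thesis by blast
    qed
  qed
qed

text \<open>As odd cuts have the parity of \<open>k\<close>, the bound \<open>2 * k - 2\<close> improves to \<open>2 * k - 1\<close> for odd \<open>k\<close>.\<close>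

lemma odd_coloring:
  fixes en :: "'e \<Rightarrow> bool \<Rightarrow> 'v"
  assumes "k > 0" and fin: "finite V" "finite E" and ends: "\<And>e h. e \<in> E \<Longrightarrow> en e h \<in> V" and Q: "Q \<subseteq> V"
    and parity: "\<forall>v\<in>V. even (deg E en v + k * of_bool (v \<in> Q))"
    and cuts: "\<And>A. A \<subseteq> V \<Longrightarrow> odd (card (A \<inter> Q)) \<Longrightarrow> 2 * k - 2 \<le> edge_cut E en A"
  shows "\<exists>c. (\<forall>e\<in>E. c e < k) \<and> (\<forall>v\<in>V. \<forall>i<k. odd (deg {e\<in>E. c e = i} en v) \<longleftrightarrow> v \<in> Q)"
proof (cases "k = 1")
  case True
  have "odd (deg E en v) \<longleftrightarrow> v \<in> Q" if "v \<in> V" for v using parity that True by auto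
  then show ?thesis using True by (intro exI[of _ "\<lambda>_. 0"]) simp
next
  case False
  let ?l = "if even k then 2 * k - 2 else 2 * k - 1"
  have "?l \<le> edge_cut E en A" if A: "A \<subseteq> V" "odd (card (A \<inter> Q))" for A
  proof -
    have "even (edge_cut E en A + k * card (A \<inter> Q))"
      by (rule edge_cut_parity[OF fin(2)]) (use A(1) parity fin finite_subset in auto)
    then have "even (edge_cut E en A + k)" using A(2) by auto
    then have "odd k \<Longrightarrow> edge_cut E en A \<noteq> 2 * k - 2" using assms(1) by auto
    then show ?thesis using cuts[OF A] by (cases "even k") auto
  qed
  then show ?thesis
    by (intro odd_coloring_large_cuts[of k ?l, OF _ _ _ fin _ Q parity]) (use False assms(1) ends in auto)
qed

section \<open>Factors of large minimum degree\<close>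

text \<open>All vertices outside \<open>V0\<close> are identified to a new vertex \<open>None\<close>, and each vertex of \<open>V0\<close>
  whose degree does not have the parity of \<open>k\<close> is joined to \<open>None\<close> by an additional edge. In this graph
  every vertex of \<open>V0\<close> can have odd degree in all colours. Deleting the additional edges changes the
  parity of at most one colour at each vertex. The label of \<open>None\<close> is chosen so that the number of odd labels is even;
  then an odd set that contains \<open>None\<close> has an odd complement, which lies in \<open>V0\<close>.\<close>

lemma at_most_one_even_color:
  fixes en :: "'e \<Rightarrow> bool \<Rightarrow> 'v"
  assumes k: "k > 0" and fin: "finite V" "finite E" and ends: "\<And>e h. e \<in> E \<Longrightarrow> en e h \<in> V" and V0: "V0 \<subseteq> V"
    and cuts: "\<And>A. A \<subseteq> V0 \<Longrightarrow> odd (card A) \<Longrightarrow> 2 * k - 2 \<le> edge_cut E en A"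
  shows "\<exists>c. (\<forall>e\<in>E. c e < k) \<and>
    (\<forall>v\<in>V0. \<forall>i<k. \<forall>j<k. i \<noteq> j \<longrightarrow> odd (deg {e\<in>E. c e = i} en v) \<or> odd (deg {e\<in>E. c e = j} en v))"
proof -
  define L where "L = {v\<in>V0. odd (deg E en v + k)}"
  define E' where "E' = Inl ` E \<union> Inr ` L"
  define en' :: "'e + 'v \<Rightarrow> bool \<Rightarrow> 'v option" where "en' = (\<lambda>x h. case x of
    Inl e \<Rightarrow> if en e h \<in> V0 then Some (en e h) else None | Inr v \<Rightarrow> if h then None else Some v)"
  define V' where "V' = insert None (Some ` V0)"
  define Q where "Q = Some ` V0 \<union> (if odd (card V0) then {None} else {})"
  have finV0: "finite V0" using V0 fin(1) finite_subset by blast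
  have finL: "finite L" using finV0 by (simp add: L_def)
  have finE': "finite E'" using fin(2) finL by (simp add: E'_def)
  have finV': "finite V'" using finV0 by (simp add: V'_def)
  have ends': "en' x h \<in> V'" if "x \<in> E'" for x h
    using that by (auto simp: E'_def en'_def V'_def L_def split: if_splits)
  have Q: "Q \<subseteq> V'" by (auto simp: Q_def V'_def)
  have deg': "deg (Inl ` F \<union> Inr ` M) en' (Some v) = deg F en v + of_bool (v \<in> M)"
    if "v \<in> V0" "F \<subseteq> E" "M \<subseteq> L" for v F M
  proof -
    have fins: "finite F" "finite M" using that fin(2) finL finite_subset by blast+
    have "deg (Inl ` F \<union> Inr ` M) en' (Some v) = deg (Inl ` F) en' (Some v) + deg (Inr ` M) en' (Some v)"
      by (rule deg_Un_disjoint) (use fins in auto)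
    also have "deg (Inl ` F) en' (Some v) = deg F en v"
      unfolding deg_def by (subst sum.reindex) (use that(1) in \<open>auto simp: ends_at_def en'_def intro!: sum.cong\<close>)
    also have "deg (Inr ` M) en' (Some v) = (\<Sum>u\<in>M. of_bool (u = v))"
      unfolding deg_def by (subst sum.reindex) (auto simp: ends_at_def en'_def intro!: sum.cong)
    also have "\<dots> = of_bool (v \<in> M)" using fins(2) by (simp add: of_bool_def)
    finally show ?thesis .
  qed
  have even_Some: "even (deg E' en' (Some v) + k)" if "v \<in> V0" for v
    unfolding E'_def deg'[OF that subset_refl subset_refl] using that by (auto simp: L_def)
  have "even (\<Sum>v\<in>V'. deg E' en' v)"
  proof -
    have none: "{e \<in> E'. (en' e False \<in> V') \<noteq> (en' e True \<in> V')} = {}" using ends' by blast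
    have "edge_cut E' en' V' = 0" unfolding edge_cut_def none by simp
    then show ?thesis unfolding sum_deg[OF finE' finV'] by simp
  qed
  moreover have "(\<Sum>v\<in>V'. deg E' en' v) = deg E' en' None + (\<Sum>v\<in>V0. deg E' en' (Some v))"
    unfolding V'_def using finV0 by (simp add: sum.reindex)
  moreover have "even ((\<Sum>v\<in>V0. deg E' en' (Some v)) + card V0 * k)"
  proof -
    have "even (\<Sum>v\<in>V0. deg E' en' (Some v) + k)" using even_Some by (intro dvd_sum) auto
    then show ?thesis by (simp add: sum.distrib)
  qed
  ultimately have even_None: "even (deg E' en' None + card V0 * k)" by auto
  have "\<exists>c. (\<forall>e\<in>E'. c e < k) \<and> (\<forall>v\<in>V'. \<forall>i<k. odd (deg {e\<in>E'. c e = i} en' v) \<longleftrightarrow> v \<in> Q)"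
  proof (rule odd_coloring[OF k finV' finE' _ Q])
    show "en' e h \<in> V'" if "e \<in> E'" for e h by (rule ends'[OF that])
    show "\<forall>v\<in>V'. even (deg E' en' v + k * of_bool (v \<in> Q))"
    proof
      fix v assume "v \<in> V'"
      then consider "v = None" | u where "v = Some u" "u \<in> V0" by (auto simp: V'_def)
      then show "even (deg E' en' v + k * of_bool (v \<in> Q))"
      proof cases
        case 1
        then show ?thesis using even_None by (auto simp: Q_def)
      next
        case 2
        then show ?thesis using even_Some by (auto simp: Q_def)
      qed
    qed
    have evenQ: "even (card Q)"
    proof -
      have "card Q = card V0 + of_bool (odd (card V0))"
        unfolding Q_def using finV0 by (auto simp: card_image card_insert_if)
      then show ?thesis by auto
    qed
    have inside: "2 * k - 2 \<le> edge_cut E' en' (Some ` B)" if B: "B \<subseteq> V0" "odd (card B)" for B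
    proof -
      have "Inl ` {e\<in>E. (en e False \<in> B) \<noteq> (en e True \<in> B)} \<subseteq> {x\<in>E'. (en' x False \<in> Some ` B) \<noteq> (en' x True \<in> Some ` B)}"
        using B(1) by (auto simp: E'_def en'_def split: if_splits)
      then have "card (Inl ` {e\<in>E. (en e False \<in> B) \<noteq> (en e True \<in> B)} :: ('e + 'v) set) \<le> edge_cut E' en' (Some ` B)"
        unfolding edge_cut_def using finE' by (intro card_mono) auto
      then have "edge_cut E en B \<le> edge_cut E' en' (Some ` B)" by (simp add: edge_cut_def card_image)
      then show ?thesis using cuts[OF B] by linarith
    qed
    show "2 * k - 2 \<le> edge_cut E' en' A" if A: "A \<subseteq> V'" "odd (card (A \<inter> Q))" for A
    proof -
      define A' where "A' = (if None \<in> A then V' - A else A)"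
      have cut: "edge_cut E' en' A' = edge_cut E' en' A"
        using edge_cut_complement[of E' en' V' A] ends' by (auto simp: A'_def)
      have "odd (card (A' \<inter> Q))"
      proof (cases "None \<in> A")
        case True
        have finQ: "finite Q" using Q finV' finite_subset by blast
        have "A' \<inter> Q = Q - A \<inter> Q" using True Q by (auto simp: A'_def)
        then have "card (A' \<inter> Q) = card Q - card (A \<inter> Q)" "card (A \<inter> Q) \<le> card Q"
          using finQ by (auto intro: card_mono simp: card_Diff_subset)
        then show ?thesis using evenQ A(2) by auto
      qed (use A in \<open>simp add: A'_def\<close>)
      define B where "B = {v\<in>V0. Some v \<in> A'}"
      have B: "A' = Some ` B" using A(1) by (auto simp: A'_def V'_def B_def)
      then have "A' \<inter> Q = A'" by (auto simp: Q_def B_def)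
      with B have "odd (card B)" using \<open>odd (card (A' \<inter> Q))\<close> by (simp add: card_image)
      moreover have "B \<subseteq> V0" by (auto simp: B_def)
      ultimately show ?thesis using inside[of B] cut B by simp
    qed
  qed
  then obtain c where c: "\<forall>e\<in>E'. c e < k" "\<And>v i. v \<in> V' \<Longrightarrow> i < k \<Longrightarrow> odd (deg {e\<in>E'. c e = i} en' v) \<longleftrightarrow> v \<in> Q" by blast
  have deg: "odd (deg {e\<in>E. c (Inl e) = i} en v + of_bool (v \<in> L \<and> c (Inr v) = i))" if "v \<in> V0" "i < k" for v i
  proof -
    have "{x\<in>E'. c x = i} = Inl ` {e\<in>E. c (Inl e) = i} \<union> Inr ` {u\<in>L. c (Inr u) = i}" by (auto simp: E'_def)
    then have "deg {x\<in>E'. c x = i} en' (Some v) = deg {e\<in>E. c (Inl e) = i} en v + of_bool (v \<in> L \<and> c (Inr v) = i)"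
      using deg'[OF that(1), of "{e\<in>E. c (Inl e) = i}" "{u\<in>L. c (Inr u) = i}"] by auto
    moreover have "Some v \<in> V'" "Some v \<in> Q" using that(1) by (auto simp: V'_def Q_def)
    ultimately show ?thesis using c(2)[of "Some v" i] that(2) by simp
  qed
  have "odd (deg {e\<in>E. c (Inl e) = i} en v) \<or> odd (deg {e\<in>E. c (Inl e) = j} en v)"
    if "v \<in> V0" "i < k" "j < k" "i \<noteq> j" for v i j
    using deg[OF that(1,2)] deg[OF that(1,3)] that(4) by (cases "c (Inr v) = i") auto
  moreover have "\<forall>e\<in>E. c (Inl e) < k" using c(1) by (auto simp: E'_def)
  ultimately show ?thesis by (intro exI[of _ "\<lambda>e. c (Inl e)"]) blast
qed

text \<open>Start from a colouring with at most one even colour at the vertices of degree less than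
  \<open>k * p + k - 1\<close> and balance it. A colour of degree less than \<open>p\<close> at a vertex would force the degree of the vertex to be too small.\<close>

lemma min_degree_k_factors:
  fixes en :: "'e \<Rightarrow> bool \<Rightarrow> 'v"
  assumes k: "k > 0" and p: "odd p" and fin: "finite V" "finite E" and ends: "\<And>e h. e \<in> E \<Longrightarrow> en e h \<in> V"
    and deg: "\<And>v. v \<in> V \<Longrightarrow> k * p \<le> deg E en v"
    and cuts: "\<And>A. A \<subseteq> {v\<in>V. deg E en v < k * p + k - 1} \<Longrightarrow> odd (card A) \<Longrightarrow> 2 * k - 2 \<le> edge_cut E en A"
  shows "\<exists>c. (\<forall>e\<in>E. c e < k) \<and> (\<forall>v\<in>V. \<forall>i<k. p \<le> deg {e\<in>E. c e = i} en v)"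
proof -
  define V0 where "V0 = {v\<in>V. deg E en v < k * p + k - 1}"
  have V0: "V0 \<subseteq> V" by (auto simp: V0_def)
  have "\<exists>c. (\<forall>e\<in>E. c e < k) \<and>
    (\<forall>v\<in>V0. \<forall>i<k. \<forall>j<k. i \<noteq> j \<longrightarrow> odd (deg {e\<in>E. c e = i} en v) \<or> odd (deg {e\<in>E. c e = j} en v))"
  proof (rule at_most_one_even_color[OF k fin _ V0])
    show "en e h \<in> V" if "e \<in> E" for e h using that by (rule ends)
    show "2 * k - 2 \<le> edge_cut E en A" if "A \<subseteq> V0" "odd (card A)" for A using cuts that by (simp add: V0_def)
  qed
  then obtain c0 where c0: "\<forall>e\<in>E. c0 e \<in> {..<k}"
    "\<forall>v\<in>V0. \<forall>i\<in>{..<k}. \<forall>j\<in>{..<k}. i \<noteq> j \<longrightarrow> odd (deg {e\<in>E. c0 e = i} en v) \<or> odd (deg {e\<in>E. c0 e = j} en v)"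
    by auto
  obtain c where c: "\<forall>e\<in>E. c e \<in> {..<k}"
    "\<forall>v\<in>V0. \<forall>i\<in>{..<k}. \<forall>j\<in>{..<k}. i \<noteq> j \<longrightarrow> odd (deg {e\<in>E. c e = i} en v) \<or> odd (deg {e\<in>E. c e = j} en v)"
    "\<forall>v\<in>V. \<forall>i\<in>{..<k}. \<forall>j\<in>{..<k}. deg {e\<in>E. c e = i} en v \<le> deg {e\<in>E. c e = j} en v + 2"
    using parity_balanced_coloring[OF fin(2,1) finite_lessThan c0 V0] by blast
  have "p \<le> deg {e\<in>E. c e = i} en v" if v: "v \<in> V" and i: "i < k" for v i
  proof (rule ccontr)
    let ?d = "\<lambda>j. deg {e\<in>E. c e = j} en v"
    assume "\<not> p \<le> ?d i"
    then have small: "?d i + 1 \<le> p" by simp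
    have total: "deg E en v = ?d i + (\<Sum>j\<in>{..<k} - {i}. ?d j)"
      using deg_color_sum[OF fin(2), of c k en v] c(1) i by (simp add: sum.remove[of "{..<k}" i])
    have others: "(\<Sum>j\<in>{..<k} - {i}. ?d j) \<le> (k - 1) * B" if "\<And>j. j < k \<Longrightarrow> j \<noteq> i \<Longrightarrow> ?d j \<le> B" for B
      using sum_bounded_above[of "{..<k} - {i}" ?d B] that i by simp
    have le2: "?d j \<le> ?d i + 2" if "j < k" for j using c(3) v i that by simp
    have kp: "k * p = (k - 1) * p + p" using k by (cases k) auto
    show False
    proof (cases "v \<in> V0")
      case True
      have "?d j \<le> p" if j: "j < k" "j \<noteq> i" for j
      proof (cases "?d i + 1 = p")
        case eq: True
        then have "even (?d i)" using p by auto
        then have odd: "odd (?d j)" using c(2) True j i by auto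
        have "?d j \<noteq> p + 1"
        proof
          assume eq: "?d j = p + 1"
          show False using odd p unfolding eq by simp
        qed
        then show ?thesis using le2[OF j(1)] eq by linarith
      next
        case False
        then show ?thesis using le2[OF j(1)] small by linarith
      qed
      then have "deg E en v \<le> ?d i + (k - 1) * p" using total others[of p] by simp
      then show False using deg[OF v] small kp by linarith
    next
      case False
      have "?d j \<le> p + 1" if "j < k" "j \<noteq> i" for j using le2[OF that(1)] small by linarith
      then have "deg E en v \<le> ?d i + (k - 1) * (p + 1)" using total others[of "p + 1"] by simp
      also have "(k - 1) * (p + 1) = (k - 1) * p + (k - 1)" by simp
      finally show False using False v small kp k unfolding V0_def by simp
    qed
  qed
  then show ?thesis using c(1) by blast
qed

text \<open>Write \<open>\<delta> i = p + 2 * b i\<close> if \<open>\<delta> i\<close> is odd and \<open>\<delta> i = 2 * b i\<close> otherwise. The colours below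
  \<open>\<kappa>\<close> are assigned to the odd values; the other edges are recoloured with the colour set
  \<open>S\<close>, which contains \<open>b i\<close> colours \<open>(i, t)\<close> for every \<open>i\<close>.\<close>

lemma min_degree_decomposition:
  fixes en :: "'e \<Rightarrow> bool \<Rightarrow> 'v" and \<delta> :: "'i \<Rightarrow> nat"
  assumes p: "odd p" and k: "k > 0" and fin: "finite E" "finite I"
    and \<delta>: "\<And>i. i \<in> I \<Longrightarrow> p - 1 \<le> \<delta> i" "k * p = (\<Sum>i\<in>I. \<delta> i)"
    and c0: "\<forall>e\<in>E. c0 e < k" "\<And>v j. v \<in> V \<Longrightarrow> j < k \<Longrightarrow> p \<le> deg {e\<in>E. c0 e = j} en v"
  shows "\<exists>c. (\<forall>e\<in>E. c e \<in> I) \<and> (\<forall>v\<in>V. \<forall>i\<in>I. \<delta> i \<le> deg {e\<in>E. c e = i} en v)"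
proof -
  define O1 where "O1 = {i\<in>I. odd (\<delta> i)}"
  define \<kappa> where "\<kappa> = card O1"
  define b where "b = (\<lambda>i. (\<delta> i - (if i \<in> O1 then p else 0)) div 2)"
  define S where "S = (SIGMA i:I. {..<b i})"
  have finO: "finite O1" "O1 \<subseteq> I" using fin(2) by (auto simp: O1_def)
  have \<delta>b: "\<delta> i = (if i \<in> O1 then p else 0) + 2 * b i" if "i \<in> I" for i
  proof (cases "i \<in> O1")
    case True
    then have "odd (\<delta> i)" by (simp add: O1_def)
    then have "p \<le> \<delta> i" using \<delta>(1)[OF that] p by (cases "\<delta> i = p - 1") auto
    moreover have "even (\<delta> i - p)" using \<open>odd (\<delta> i)\<close> p by simp
    ultimately show ?thesis using True by (simp add: b_def)
  qed (use that in \<open>auto simp: b_def O1_def\<close>)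
  have finS: "finite S" and cardS: "card S = (\<Sum>i\<in>I. b i)" using fin(2) by (auto simp: S_def)
  have "(\<Sum>i\<in>I. \<delta> i) = (\<Sum>i\<in>I. if i \<in> O1 then p else 0) + 2 * (\<Sum>i\<in>I. b i)"
    by (simp add: \<delta>b sum.distrib sum_distrib_left cong: sum.cong)
  also have "(\<Sum>i\<in>I. if i \<in> O1 then p else 0) = (\<Sum>i\<in>O1. p)"
    using fin(2) finO by (simp add: sum.If_cases Int_absorb1)
  finally have sum: "k * p = \<kappa> * p + 2 * card S" using \<delta>(2) cardS by (simp add: \<kappa>_def)
  have "p > 0" using p by (cases p) auto
  then have \<kappa>k: "\<kappa> \<le> k" using sum by (metis le_add1 mult_le_cancel2)
  have S2: "2 * card S = (k - \<kappa>) * p" using sum by (simp add: diff_mult_distrib)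
  obtain h where h: "bij_betw h {..<\<kappa>} O1"
    using ex_bij_betw_nat_finite[OF finO(1)] unfolding \<kappa>_def atLeast0LessThan by blast
  define EU where "EU = {e\<in>E. \<kappa> \<le> c0 e}"
  have finEU: "finite EU" using fin(1) by (simp add: EU_def)
  have "\<exists>g. (\<forall>e\<in>EU. g e \<in> S) \<and> (\<forall>v\<in>V. \<forall>s\<in>S. 2 \<le> deg {e\<in>EU. g e = s} en v)"
  proof (cases "S = {}")
    case True
    then have "k = \<kappa>" using S2 \<open>p > 0\<close> \<kappa>k by simp
    then have "EU = {}" using c0(1) by (auto simp: EU_def)
    then show ?thesis using True by simp
  next
    case False
    have "2 * card S \<le> deg EU en v" if "v \<in> V" for v
    proof -
      have "deg EU en v = (\<Sum>j\<in>{\<kappa>..<k}. deg {e\<in>EU. c0 e = j} en v)"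
        unfolding deg_def by (rule sum.group[symmetric]) (use finEU c0(1) in \<open>auto simp: EU_def\<close>)
      also have "\<dots> = (\<Sum>j\<in>{\<kappa>..<k}. deg {e\<in>E. c0 e = j} en v)"
        by (intro sum.cong refl arg_cong[where f = "\<lambda>F. deg F en v"]) (auto simp: EU_def)
      also have "\<dots> \<ge> (\<Sum>j\<in>{\<kappa>..<k}. p)" using c0(2)[OF that] by (intro sum_mono) auto
      finally show ?thesis using S2 by simp
    qed
    then show ?thesis by (intro min_degree_two_classes[OF finEU finS False]) blast
  qed
  then obtain g where g: "\<forall>e\<in>EU. g e \<in> S" "\<And>v s. v \<in> V \<Longrightarrow> s \<in> S \<Longrightarrow> 2 \<le> deg {e\<in>EU. g e = s} en v" by blast
  define c where "c = (\<lambda>e. if c0 e < \<kappa> then h (c0 e) else fst (g e))"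
  have "c e \<in> I" if "e \<in> E" for e
  proof (cases "c0 e < \<kappa>")
    case True
    then have "h (c0 e) \<in> O1" using h by (auto simp: bij_betw_def)
    then show ?thesis using True finO(2) by (auto simp: c_def)
  next
    case False
    then have "g e \<in> S" using g(1) that by (auto simp: EU_def)
    then show ?thesis using False by (auto simp: c_def S_def)
  qed
  moreover have "\<delta> i \<le> deg {e\<in>E. c e = i} en v" if v: "v \<in> V" and i: "i \<in> I" for v i
  proof -
    let ?F1 = "{e\<in>E. c0 e < \<kappa> \<and> h (c0 e) = i}" and ?F2 = "{e\<in>EU. fst (g e) = i}"
    have eq: "{e\<in>E. c e = i} = ?F1 \<union> ?F2" by (auto simp: c_def EU_def)
    have "deg {e\<in>E. c e = i} en v = deg ?F1 en v + deg ?F2 en v"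
      unfolding eq by (rule deg_Un_disjoint) (use fin(1) finEU in \<open>auto simp: EU_def\<close>)
    moreover have "(if i \<in> O1 then p else 0) \<le> deg ?F1 en v"
    proof (cases "i \<in> O1")
      case True
      then obtain j where j: "j < \<kappa>" "h j = i" using h by (auto simp: bij_betw_def)
      have "p \<le> deg {e\<in>E. c0 e = j} en v" using c0(2)[OF v] j(1) \<kappa>k by simp
      also have "\<dots> \<le> deg ?F1 en v" unfolding deg_def using fin(1) j by (intro sum_mono2) auto
      finally show ?thesis using True by simp
    qed simp
    moreover have "2 * b i \<le> deg ?F2 en v"
    proof -
      let ?T = "{i} \<times> {..<b i}"
      have "?F2 = {e\<in>EU. g e \<in> ?T}" using g(1) by (force simp: S_def)
      then have "deg ?F2 en v = (\<Sum>s\<in>?T. deg {e\<in>?F2. g e = s} en v)"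
        unfolding deg_def using finEU by (intro sum.group[symmetric]) auto
      also have "\<dots> = (\<Sum>s\<in>?T. deg {e\<in>EU. g e = s} en v)"
        by (intro sum.cong refl arg_cong[where f = "\<lambda>F. deg F en v"]) auto
      also have "\<dots> \<ge> (\<Sum>s\<in>?T. 2)" using g(2)[OF v] i by (intro sum_mono) (auto simp: S_def)
      finally show ?thesis by (simp add: card_cartesian_product)
    qed
    ultimately show ?thesis using \<delta>b[OF i] by simp
  qed
  ultimately show ?thesis by blast
qed

section \<open>The decomposition theorem\<close>

lemma degree_eq_deg:
  assumes "finite (edges H)" "\<And>e. e \<in> edges H \<Longrightarrow> ends H e = Upair (en e False) (en e True)"
  shows "degree H v = deg (edges H) en v"
proof -
  have "degree H v = card {e\<in>edges H. v \<in> {en e False, en e True}} + card {e\<in>edges H. en e False = v \<and> en e True = v}"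
    unfolding degree_def using assms(2) by (intro arg_cong2[where f = "(+)"] arg_cong[where f = card]) auto
  also have "\<dots> = (\<Sum>e\<in>edges H. of_bool (v \<in> {en e False, en e True}) + of_bool (en e False = v \<and> en e True = v))"
    using assms(1) by (simp add: sum.distrib of_bool_def flip: sum.inter_filter)
  also have "\<dots> = deg (edges H) en v"
    unfolding deg_def by (rule sum.cong) (auto simp: ends_at_def)
  finally show ?thesis .
qed

theorem corollary6p11:
  fixes G :: "('v, 'e) mgraph" and k p m :: nat and \<delta> :: "nat \<Rightarrow> nat" and V0 :: "'v set"
  assumes "k > 0"
    and "odd p" and "p \<ge> 3"
    and "\<And>i. i \<in> {1..m} \<Longrightarrow> \<delta> i > 0"
    and "\<And>i. i \<in> {1..m} \<Longrightarrow> \<delta> i \<ge> p - 1"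
    and "k * p = (\<Sum>i = 1..m. \<delta> i)"
    and "finite_mgraph G"
    and "even (card (verts G))"
    and "min_degree G \<ge> (\<Sum>i = 1..m. \<delta> i)"
    and "V0 = {v \<in> verts G. degree G v \<le> k * p + k - 2}"
    and "partially_odd_edge_connected G V0 (3 * k - 3) V0"
  shows "\<exists>H :: nat \<Rightarrow> ('v, 'e) mgraph.
    edge_decomposition G {1..m} H \<and> (\<forall>i \<in> {1..m}. min_degree (H i) \<ge> \<delta> i)"
proof -
  interpret finite_mgraph G by (rule assms(7))
  have "\<exists>f. ends G e = Upair (f False) (f True)" for e
  proof -
    obtain x y where "ends G e = Upair x y" by (cases "ends G e") auto
    then show ?thesis by (intro exI[of _ "\<lambda>h. if h then y else x"]) simp
  qed
  then obtain en where en: "\<And>e. ends G e = Upair (en e False) (en e True)" by metis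
  have deg: "degree G v = deg (edges G) en v" for v by (rule degree_eq_deg[OF finite_edges en])
  have in_verts: "en e h \<in> verts G" if "e \<in> edges G" for e h
    using ends_in_verts[OF that] unfolding en by (cases h) auto
  have "\<exists>c. (\<forall>e\<in>edges G. c e < k) \<and> (\<forall>v\<in>verts G. \<forall>i<k. p \<le> deg {e\<in>edges G. c e = i} en v)"
  proof (rule min_degree_k_factors[OF assms(1,2) finite_verts finite_edges in_verts])
    show "k * p \<le> deg (edges G) en v" if "v \<in> verts G" for v
    proof -
      have "min_degree G \<le> degree G v" unfolding min_degree_def using that finite_verts by (intro Min_le) auto
      then show ?thesis using assms(6,9) deg[of v] by linarith
    qed
    show "2 * k - 2 \<le> edge_cut (edges G) en A"
      if A: "A \<subseteq> {v\<in>verts G. deg (edges G) en v < k * p + k - 1}" "odd (card A)" for A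
    proof -
      have "A \<subseteq> V0" using A(1) unfolding assms(10) deg by auto
      then have "3 * k - 3 \<le> cut_degree G A"
        using assms(11) A(2) unfolding partially_odd_edge_connected_def by (simp add: Int_absorb2)
      also have "cut_degree G A = edge_cut (edges G) en A"
        unfolding cut_degree_def edge_cut_def en by (intro arg_cong[where f = card]) auto
      finally show ?thesis using assms(1) by linarith
    qed
  qed auto
  then obtain c0 where c0: "\<forall>e\<in>edges G. c0 e < k"
    "\<And>v i. v \<in> verts G \<Longrightarrow> i < k \<Longrightarrow> p \<le> deg {e\<in>edges G. c0 e = i} en v" by blast
  have "\<exists>c. (\<forall>e\<in>edges G. c e \<in> {1..m}) \<and> (\<forall>v\<in>verts G. \<forall>i\<in>{1..m}. \<delta> i \<le> deg {e\<in>edges G. c e = i} en v)"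
    by (rule min_degree_decomposition[OF assms(2,1) finite_edges finite_atLeastAtMost assms(5,6) c0])
  then obtain c where c: "\<forall>e\<in>edges G. c e \<in> {1..m}"
    "\<And>v i. v \<in> verts G \<Longrightarrow> i \<in> {1..m} \<Longrightarrow> \<delta> i \<le> deg {e\<in>edges G. c e = i} en v" by blast
  define H where "H = (\<lambda>i. \<lparr>verts = verts G, edges = {e\<in>edges G. c e = i}, ends = ends G\<rparr>)"
  have "edge_decomposition G {1..m} H"
    using c(1) unfolding edge_decomposition_def is_factor_def disjoint_family_on_def by (auto simp: H_def)
  moreover have "\<delta> i \<le> min_degree (H i)" if i: "i \<in> {1..m}" for i
  proof (cases "verts G = {}")
    case True
    \<comment> \<open>Without vertices, both minimum degrees are the same unspecified value \<open>Min {}\<close>.\<close>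
    then have "min_degree (H i) = min_degree G" by (simp add: min_degree_def H_def)
    then show ?thesis using assms(9) member_le_sum[of i "{1..m}" \<delta>] i by simp
  next
    case False
    have "degree (H i) v = deg {e\<in>edges G. c e = i} en v" for v
      using degree_eq_deg[of "H i" en v] finite_edges en by (simp add: H_def)
    then show ?thesis using c(2)[OF _ i] False finite_verts by (simp add: min_degree_def H_def)
  qed
  ultimately show ?thesis by blast
qed

end
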